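(* Let $\mathcal{L}\in\{\Lambda,\Lambda_{sp}\}$. Then $\mathcal{L}$-anti-unification is nullary: there exist closed terms $s,t\in\Lambda_c(\Sigma)$ of the same type for which no minimal complete set of $\mathcal{L}$-generalizations exists. (Such a pair is $s=\lambda x{:}\alpha.\lambda y{:}\alpha.f(x)$, $t=\lambda x{:}\alpha.\lambda y{:}\alpha.f(y)$ with $f\in\Sigma$ a constant of type $\alpha\to\alpha$.)
   Context: Simply-typed $\lambda$-calculus: types are built from a set $\mathcal{B}$ of base types, containing at least one base type $\alpha$, by $\tau::=\mathcal{B}\mid\tau\to\tau$. Variables are split into free variables (written $X,Y,Z,\dots$) and bound variables (written $x,y,z,\dots$); constants come from a signature $\Sigma$, which is assumed to contain at least one constant of every type, and in particular a constant $f$ of type $\alpha\to\alpha$. Terms are $t::=x\mid Y\mid c\mid\lambda x.t\mid t_1\,t_2$, well typed, with bound variables never occurring unabstracted, and are taken in $\eta$-long $\beta$-normal form; $\Lambda=\Lambda(\Sigma)$ is the set of all such terms, $\Lambda_c$ the closed ones (no free variables). ${\sf h}(t_1,\dots,t_m)$ abbreviates iterated application; $\mathit{head}(\lambda x.t')=\lambda x.$ and $\mathit{head}({\sf h}(\overline{s_m}))={\sf h}$; $t\downarrow_\eta$ is the $\eta$-normal form. Substitutions are finite type-preserving maps from free variables to terms, applied capture-avoidingly, written postfix. A term $t$ is a superpattern if for every subterm whose $\eta$-normal form is $X(s_1,\dots,s_m)$ with $X$ free: each $s_i\downarrow_\eta$ is either a bound variable of $t$ or has a free variable as head, and any two arguments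 $s_i\downarrow_\eta,s_j\downarrow_\eta$ ($i\neq j$) that are bound variables are distinct; $\Lambda_{sp}$ is the set of superpatterns. For $\mathcal{L}\in\{\Lambda,\Lambda_{sp}\}$ and closed $s,t$ of the same type, a term $g\in\mathcal{L}$ is an $\mathcal{L}$-generalization of $s,t$ if there exist substitutions $\sigma_1,\sigma_2$ with $g\sigma_1=_{\alpha\beta\eta}s$ and $g\sigma_2=_{\alpha\beta\eta}t$; $\mathcal{G}_{\mathcal{L}}(s,t)$ is the set of these. For $\mathcal{L}$-terms, $g\le_{\mathcal{L}}g'$ iff there is a substitution $\sigma$ with $g\sigma=_{\alpha\beta\eta}g'$. A set $C\subseteq\mathcal{G}_{\mathcal{L}}(s,t)$ is complete if for every $g'\in\mathcal{G}_{\mathcal{L}}(s,t)$ there is $g\in C$ with $g'\le_{\mathcal{L}}g$; it is minimal complete if moreover distinct elements of $C$ are $\le_{\mathcal{L}}$-incomparable. $\mathcal{L}$-anti-unification is nullary if there exist closed $s,t$ for which no minimal complete set exists. *)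

theory Defs
  imports Main
begin

text \<open>
  Simply typed terms: bound variables are de Bruijn indices and
  free variables carry a name and a type, so terms are identified up to renaming of bound
  variables. The base types are the elements of \<open>'b\<close>, the constants of the signature are the
  elements of \<open>'c\<close>, and \<open>ctype :: 'c \<Rightarrow> 'b ty\<close> gives their types.
\<close>

datatype 'b ty = Base 'b | Fun "'b ty" "'b ty"  (infixr \<open>\<rightarrow>\<^sub>t\<close> 65)

type_synonym 'b fvar = "nat \<times> 'b ty"

datatype ('b, 'c) trm =
    Bound nat
  | Free "'b fvar"
  | Const 'c
  | Lam "'b ty" "('b, 'c) trm"
  | App "('b, 'c) trm" "('b, 'c) trm"

inductive has_type :: "('c \<Rightarrow> 'b ty) \<Rightarrow> 'b ty list \<Rightarrow> ('b, 'c) trm \<Rightarrow> 'b ty \<Rightarrow> bool"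
  for ctype :: "'c \<Rightarrow> 'b ty" where
  "i < length \<Gamma> \<Longrightarrow> has_type ctype \<Gamma> (Bound i) (\<Gamma> ! i)"
| "has_type ctype \<Gamma> (Free X) (snd X)"
| "has_type ctype \<Gamma> (Const c) (ctype c)"
| "has_type ctype (A # \<Gamma>) t B \<Longrightarrow> has_type ctype \<Gamma> (Lam A t) (A \<rightarrow>\<^sub>t B)"
| "has_type ctype \<Gamma> t (A \<rightarrow>\<^sub>t B) \<Longrightarrow> has_type ctype \<Gamma> u A \<Longrightarrow> has_type ctype \<Gamma> (App t u) B"

primrec fvars :: "('b, 'c) trm \<Rightarrow> 'b fvar set" where
  "fvars (Bound i) = {}"
| "fvars (Free X) = {X}"
| "fvars (Const c) = {}"
| "fvars (Lam A t) = fvars t"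
| "fvars (App t u) = fvars t \<union> fvars u"

primrec lift :: "('b, 'c) trm \<Rightarrow> nat \<Rightarrow> ('b, 'c) trm" where
  "lift (Bound i) k = (if i < k then Bound i else Bound (Suc i))"
| "lift (Free X) k = Free X"
| "lift (Const c) k = Const c"
| "lift (Lam A t) k = Lam A (lift t (Suc k))"
| "lift (App t u) k = App (lift t k) (lift u k)"

text \<open>\<open>bsubst t u k\<close> replaces index \<open>k\<close> in \<open>t\<close> by \<open>u\<close> and removes the binder of \<open>k\<close>.\<close>

primrec bsubst :: "('b, 'c) trm \<Rightarrow> ('b, 'c) trm \<Rightarrow> nat \<Rightarrow> ('b, 'c) trm" where
  "bsubst (Bound i) u k = (if k < i then Bound (i - 1) else if i = k then u else Bound i)"
| "bsubst (Free X) u k = Free X"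
| "bsubst (Const c) u k = Const c"
| "bsubst (Lam A t) u k = Lam A (bsubst t (lift u 0) (Suc k))"
| "bsubst (App t s) u k = App (bsubst t u k) (bsubst s u k)"

inductive beta :: "('b, 'c) trm \<Rightarrow> ('b, 'c) trm \<Rightarrow> bool" where
  "beta (App (Lam A t) u) (bsubst t u 0)"
| "beta t t' \<Longrightarrow> beta (App t u) (App t' u)"
| "beta u u' \<Longrightarrow> beta (App t u) (App t u')"
| "beta t t' \<Longrightarrow> beta (Lam A t) (Lam A t')"

inductive eta :: "('b, 'c) trm \<Rightarrow> ('b, 'c) trm \<Rightarrow> bool" where
  "eta (Lam A (App (lift t 0) (Bound 0))) t"
| "eta t t' \<Longrightarrow> eta (App t u) (App t' u)"
| "eta u u' \<Longrightarrow> eta (App t u) (App t u')"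
| "eta t t' \<Longrightarrow> eta (Lam A t) (Lam A t')"

definition eta_normal_form :: "('b, 'c) trm \<Rightarrow> ('b, 'c) trm \<Rightarrow> bool" where
  "eta_normal_form t v \<longleftrightarrow> eta\<^sup>*\<^sup>* t v \<and> (\<nexists>w. eta v w)"

text \<open>
  Conversion is restricted to steps between well-typed terms: because abstractions carry type
  annotations, conversion through ill-typed terms would identify terms differing in them.
\<close>

definition typed_step :: "('c \<Rightarrow> 'b ty) \<Rightarrow> ('b, 'c) trm \<Rightarrow> ('b, 'c) trm \<Rightarrow> bool" where
  "typed_step ctype t u \<longleftrightarrow>
     (\<exists>T. has_type ctype [] t T \<and> has_type ctype [] u T) \<and> (beta t u \<or> eta t u)"

definition conv :: "('c \<Rightarrow> 'b ty) \<Rightarrow> ('b, 'c) trm \<Rightarrow> ('b, 'c) trm \<Rightarrow> bool" where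
  "conv ctype = equivclp (typed_step ctype)"

text \<open>
  \<open>long_nf ctype \<Gamma> t T\<close>: \<open>t\<close> is an \<open>\<eta>\<close>-long \<open>\<beta>\<close>-normal form of type \<open>T\<close>, i.e.\ of the shape
  \<open>\<lambda>x\<^sub>1\<dots>x\<^sub>n. h(t\<^sub>1,\<dots>,t\<^sub>m)\<close> with \<open>h\<close> a variable or constant, \<open>h(t\<^sub>1,\<dots>,t\<^sub>m)\<close> of base type, and
  the \<open>t\<^sub>i\<close> again of this form. \<open>neutral\<close> describes the partial applications
  \<open>h(t\<^sub>1,\<dots>,t\<^sub>j)\<close>, \<open>j \<le> m\<close>.
\<close>

inductive long_nf :: "('c \<Rightarrow> 'b ty) \<Rightarrow> 'b ty list \<Rightarrow> ('b, 'c) trm \<Rightarrow> 'b ty \<Rightarrow> bool"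
  and neutral :: "('c \<Rightarrow> 'b ty) \<Rightarrow> 'b ty list \<Rightarrow> ('b, 'c) trm \<Rightarrow> 'b ty \<Rightarrow> bool"
  for ctype :: "'c \<Rightarrow> 'b ty" where
  "long_nf ctype (A # \<Gamma>) t B \<Longrightarrow> long_nf ctype \<Gamma> (Lam A t) (A \<rightarrow>\<^sub>t B)"
| "neutral ctype \<Gamma> t (Base b) \<Longrightarrow> long_nf ctype \<Gamma> t (Base b)"
| "i < length \<Gamma> \<Longrightarrow> neutral ctype \<Gamma> (Bound i) (\<Gamma> ! i)"
| "neutral ctype \<Gamma> (Free X) (snd X)"
| "neutral ctype \<Gamma> (Const c) (ctype c)"
| "neutral ctype \<Gamma> t (A \<rightarrow>\<^sub>t B) \<Longrightarrow> long_nf ctype \<Gamma> u A \<Longrightarrow> neutral ctype \<Gamma> (App t u) B"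

definition Terms :: "('c \<Rightarrow> 'b ty) \<Rightarrow> ('b, 'c) trm set" where
  "Terms ctype = {t. \<exists>T. long_nf ctype [] t T}"

definition closed_term :: "('c \<Rightarrow> 'b ty) \<Rightarrow> ('b, 'c) trm \<Rightarrow> 'b ty \<Rightarrow> bool" where
  "closed_term ctype t T \<longleftrightarrow> long_nf ctype [] t T \<and> fvars t = {}"

fun head :: "('b, 'c) trm \<Rightarrow> ('b, 'c) trm" where
  "head (App t u) = head t"
| "head t = t"

primrec subterms :: "('b, 'c) trm \<Rightarrow> ('b, 'c) trm set" where
  "subterms (Bound i) = {Bound i}"
| "subterms (Free X) = {Free X}"
| "subterms (Const c) = {Const c}"
| "subterms (Lam A t) = insert (Lam A t) (subterms t)"
| "subterms (App t u) = insert (App t u) (subterms t \<union> subterms u)"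

text \<open>
  Every argument in \<open>ss\<close> is itself \<open>\<eta>\<close>-normal, being part of an \<open>\<eta>\<close>-normal term. For
  \<open>t \<in> Terms ctype\<close>, the loose indices of a subterm are exactly the bound variables of \<open>t\<close>
  whose binder lies outside of that subterm.
\<close>

definition superpattern :: "('b, 'c) trm \<Rightarrow> bool" where
  "superpattern t \<longleftrightarrow>
     (\<forall>u \<in> subterms t. \<forall>X ss. eta_normal_form u (foldl App (Free X) ss) \<longrightarrow>
        (\<forall>s \<in> set ss. (\<exists>i. s = Bound i) \<or> (\<exists>Y. head s = Free Y)) \<and>
        (\<forall>i < length ss. \<forall>j < length ss. i \<noteq> j \<longrightarrow>
           (\<exists>k. ss ! i = Bound k) \<longrightarrow> (\<exists>k. ss ! j = Bound k) \<longrightarrow> ss ! i \<noteq> ss ! j))"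

definition Superpatterns :: "('c \<Rightarrow> 'b ty) \<Rightarrow> ('b, 'c) trm set" where
  "Superpatterns ctype = {t \<in> Terms ctype. superpattern t}"

type_synonym ('b, 'c) substitution = "'b fvar \<rightharpoonup> ('b, 'c) trm"

definition is_substitution :: "('c \<Rightarrow> 'b ty) \<Rightarrow> ('b, 'c) substitution \<Rightarrow> bool" where
  "is_substitution ctype \<sigma> \<longleftrightarrow>
     finite (dom \<sigma>) \<and> (\<forall>X t. \<sigma> X = Some t \<longrightarrow> long_nf ctype [] t (snd X))"

text \<open>
  No lifting is needed below a binder, since the terms in the range of a substitution have no
  loose indices. The result need not be \<open>\<beta>\<close>-normal; it is only ever compared up to \<open>conv\<close>.
\<close>

primrec subst :: "('b, 'c) substitution \<Rightarrow> ('b, 'c) trm \<Rightarrow> ('b, 'c) trm" where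
  "subst \<sigma> (Bound i) = Bound i"
| "subst \<sigma> (Free X) = (case \<sigma> X of None \<Rightarrow> Free X | Some t \<Rightarrow> t)"
| "subst \<sigma> (Const c) = Const c"
| "subst \<sigma> (Lam A t) = Lam A (subst \<sigma> t)"
| "subst \<sigma> (App t u) = App (subst \<sigma> t) (subst \<sigma> u)"

text \<open>In the following, \<open>L\<close> is the set \<open>Terms ctype\<close> or \<open>Superpatterns ctype\<close>.\<close>

definition generalizations ::
    "('c \<Rightarrow> 'b ty) \<Rightarrow> ('b, 'c) trm set \<Rightarrow> ('b, 'c) trm \<Rightarrow> ('b, 'c) trm \<Rightarrow> ('b, 'c) trm set" where
  "generalizations ctype L s t =
     {g \<in> L. \<exists>\<sigma>\<^sub>1 \<sigma>\<^sub>2. is_substitution ctype \<sigma>\<^sub>1 \<and> is_substitution ctype \<sigma>\<^sub>2 \<and>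
        conv ctype (subst \<sigma>\<^sub>1 g) s \<and> conv ctype (subst \<sigma>\<^sub>2 g) t}"

definition more_general ::
    "('c \<Rightarrow> 'b ty) \<Rightarrow> ('b, 'c) trm set \<Rightarrow> ('b, 'c) trm \<Rightarrow> ('b, 'c) trm \<Rightarrow> bool" where
  "more_general ctype L g g' \<longleftrightarrow>
     g \<in> L \<and> g' \<in> L \<and> (\<exists>\<sigma>. is_substitution ctype \<sigma> \<and> conv ctype (subst \<sigma> g) g')"

definition complete_set ::
    "('c \<Rightarrow> 'b ty) \<Rightarrow> ('b, 'c) trm set \<Rightarrow> ('b, 'c) trm \<Rightarrow> ('b, 'c) trm \<Rightarrow> ('b, 'c) trm set \<Rightarrow> bool"
  where
  "complete_set ctype L s t C \<longleftrightarrow>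
     C \<subseteq> generalizations ctype L s t \<and>
     (\<forall>g' \<in> generalizations ctype L s t. \<exists>g \<in> C. more_general ctype L g' g)"

definition minimal_complete ::
    "('c \<Rightarrow> 'b ty) \<Rightarrow> ('b, 'c) trm set \<Rightarrow> ('b, 'c) trm \<Rightarrow> ('b, 'c) trm \<Rightarrow> ('b, 'c) trm set \<Rightarrow> bool"
  where
  "minimal_complete ctype L s t C \<longleftrightarrow>
     complete_set ctype L s t C \<and>
     (\<forall>g \<in> C. \<forall>g' \<in> C. g \<noteq> g' \<longrightarrow>
        \<not> more_general ctype L g g' \<and> \<not> more_general ctype L g' g)"

definition nullary_pair ::
    "('c \<Rightarrow> 'b ty) \<Rightarrow> ('b, 'c) trm set \<Rightarrow> ('b, 'c) trm \<Rightarrow> ('b, 'c) trm \<Rightarrow> bool" where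
  "nullary_pair ctype L s t \<longleftrightarrow>
     (\<exists>T. closed_term ctype s T \<and> closed_term ctype t T) \<and>
     (\<nexists>C. minimal_complete ctype L s t C)"

definition nullary :: "('c \<Rightarrow> 'b ty) \<Rightarrow> ('b, 'c) trm set \<Rightarrow> bool" where
  "nullary ctype L \<longleftrightarrow> (\<exists>s t. nullary_pair ctype L s t)"

end

theory Submission
  imports Defs "HOL-Library.Nat_Bijection"
begin

text \<open>
  Let \<open>G r\<close> be \<open>\<lambda>x y. f r\<close>, so that the two terms are \<open>G x\<close> and \<open>G y\<close>. A generalization above
  \<open>G (Y x y)\<close> has the form \<open>G r\<close>. If \<open>\<sigma>\<^sub>1\<close> and \<open>\<sigma>\<^sub>2\<close> send \<open>r\<close> to \<open>x\<close> and \<open>y\<close>, then replacing every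
  free variable \<open>Z\<close> of \<open>r\<close> by \<open>\<lambda>w. Y (\<sigma>\<^sub>1 Z w) (\<sigma>\<^sub>2 Z w)\<close>, with the constants in \<open>\<sigma>\<^sub>1\<close>, \<open>\<sigma>\<^sub>2\<close> turned into
  free variables, gives an instance whose normal form has only \<open>Y\<close>s on its leftmost branch, which ends in
  \<open>x\<close>, and on its rightmost branch, which ends in \<open>y\<close>. The substitution
  \<open>Y \<mapsto> \<lambda>u v. Y (P (Y (P u) (P v))) (P v)\<close> yields a generalization that is strictly more specific:
  for any values of \<open>Y\<close> and \<open>P\<close> the leftmost branch of the result has an even multiple of the
  original number of \<open>Y\<close>s or no longer ends in \<open>x\<close>. Hence no generalization above \<open>G (Y x y)\<close> is
  maximal, while a minimal complete set would have to contain a maximal one. The factors \<open>P\<close> keep the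
  arguments of \<open>Y\<close> from being equal bound variables, so superpatterns are preserved.

  Convertibility is refuted by evaluation in a finite model, which replaces confluence.
\<close>

section \<open>Typing and normalization\<close>

lemma has_type_lift:
  assumes "has_type ctype \<Delta> t T" "\<Delta> = \<Gamma>1 @ \<Gamma>2"
  shows "has_type ctype (\<Gamma>1 @ A # \<Gamma>2) (lift t (length \<Gamma>1)) T"
  using assms
proof (induction arbitrary: \<Gamma>1 rule: has_type.induct)
  case (1 i \<Delta>)
  have eq: "\<Delta> ! i = (\<Gamma>1 @ A # \<Gamma>2) ! (if i < length \<Gamma>1 then i else Suc i)"
    using 1 by (auto simp: nth_append Suc_diff_le)
  show ?case
    unfolding eq using 1 has_type.intros(1)[of _ "\<Gamma>1 @ A # \<Gamma>2" ctype] by auto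
next
  case (4 B \<Delta> t C)
  have "has_type ctype ((B # \<Gamma>1) @ A # \<Gamma>2) (lift t (length (B # \<Gamma>1))) C"
    using 4 by (intro 4(2)) auto
  then show ?case by (auto intro: has_type.intros)
qed (auto intro: has_type.intros)

lemma long_nf_neutral_lift:
  shows "long_nf ctype \<Delta> t T \<Longrightarrow> \<Delta> = \<Gamma>1 @ \<Gamma>2 \<Longrightarrow> long_nf ctype (\<Gamma>1 @ A # \<Gamma>2) (lift t (length \<Gamma>1)) T"
    and "neutral ctype \<Delta> t T \<Longrightarrow> \<Delta> = \<Gamma>1 @ \<Gamma>2 \<Longrightarrow> neutral ctype (\<Gamma>1 @ A # \<Gamma>2) (lift t (length \<Gamma>1)) T"
proof (induction arbitrary: \<Gamma>1 and \<Gamma>1 rule: long_nf_neutral.inducts)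
  case (3 i \<Delta>)
  have eq: "\<Delta> ! i = (\<Gamma>1 @ A # \<Gamma>2) ! (if i < length \<Gamma>1 then i else Suc i)"
    using 3 by (auto simp: nth_append Suc_diff_le)
  show ?case
    unfolding eq using 3 long_nf_neutral.intros(3)[of _ "\<Gamma>1 @ A # \<Gamma>2" ctype] by auto
next
  case (1 B \<Delta> t C)
  have "long_nf ctype ((B # \<Gamma>1) @ A # \<Gamma>2) (lift t (length (B # \<Gamma>1))) C"
    using 1 by (intro 1(2)) auto
  then show ?case by (auto intro: long_nf_neutral.intros)
qed (auto intro: long_nf_neutral.intros)

lemma long_nf_has_type:
  shows "long_nf ctype \<Gamma> t T \<Longrightarrow> has_type ctype \<Gamma> t T"
    and "neutral ctype \<Gamma> t T \<Longrightarrow> has_type ctype \<Gamma> t T"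
  by (induction rule: long_nf_neutral.inducts) (auto intro: has_type.intros)

inductive_cases has_type_BoundE: "has_type ctype \<Gamma> (Bound i) T"
inductive_cases has_type_FreeE: "has_type ctype \<Gamma> (Free X) T"
inductive_cases has_type_ConstE: "has_type ctype \<Gamma> (Const c) T"
inductive_cases has_type_LamE: "has_type ctype \<Gamma> (Lam A t) T"
inductive_cases has_type_AppE: "has_type ctype \<Gamma> (App t u) T"

lemmas has_type_elims = has_type_BoundE has_type_FreeE has_type_ConstE has_type_LamE has_type_AppE

lemma has_type_unlift:
  assumes "has_type ctype (\<Gamma>1 @ A # \<Gamma>2) (lift t (length \<Gamma>1)) T"
  shows "has_type ctype (\<Gamma>1 @ \<Gamma>2) t T"
  using assms
proof (induction t arbitrary: \<Gamma>1 T)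
  case (Bound i)
  have "T = (\<Gamma>1 @ \<Gamma>2) ! i" "i < length (\<Gamma>1 @ \<Gamma>2)"
    using Bound by (auto simp: nth_append Suc_diff_le split: if_splits elim!: has_type_elims)
  then show ?case by (auto intro: has_type.intros(1))
next
  case (Lam B t)
  from Lam(2) obtain C where "T = B \<rightarrow>\<^sub>t C" "has_type ctype ((B # \<Gamma>1) @ A # \<Gamma>2) (lift t (length (B # \<Gamma>1))) C"
    by (auto elim!: has_type_elims)
  then show ?case using Lam(1)[of "B # \<Gamma>1"] by (auto intro: has_type.intros)
qed (fastforce elim!: has_type_elims intro: has_type.intros)+

lemma has_type_bsubst:
  assumes "has_type ctype \<Delta> t T" "\<Delta> = \<Gamma>1 @ A # \<Gamma>2" "has_type ctype (\<Gamma>1 @ \<Gamma>2) u A"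
  shows "has_type ctype (\<Gamma>1 @ \<Gamma>2) (bsubst t u (length \<Gamma>1)) T"
  using assms
proof (induction arbitrary: \<Gamma>1 u rule: has_type.induct)
  case (1 i \<Delta>)
  show ?case
  proof (cases "i = length \<Gamma>1")
    case True
    then show ?thesis using 1 by simp
  next
    case False
    have eq: "\<Delta> ! i = (\<Gamma>1 @ \<Gamma>2) ! (if length \<Gamma>1 < i then i - 1 else i)"
      using 1 False by (cases "i < length \<Gamma>1") (auto simp: nth_append nth_Cons' Suc_diff_Suc)
    show ?thesis
      unfolding eq using 1 False has_type.intros(1)[of _ "\<Gamma>1 @ \<Gamma>2" ctype] by auto
  qed
next
  case (4 B \<Delta> t C)
  have "has_type ctype ((B # \<Gamma>1) @ \<Gamma>2) (bsubst t (lift u 0) (length (B # \<Gamma>1))) C"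
    using 4 has_type_lift[of ctype "\<Gamma>1 @ \<Gamma>2" u A "[]" "\<Gamma>1 @ \<Gamma>2" B] by (intro 4(2)) auto
  then show ?case by (auto intro: has_type.intros)
next
  case (5 \<Delta> t B C s)
  then show ?case using has_type.intros(5)[of ctype _ _ B C] by auto
qed (auto intro: has_type.intros)

lemma has_type_unique: "has_type ctype \<Gamma> t T \<Longrightarrow> has_type ctype \<Gamma> t T' \<Longrightarrow> T = T'"
proof (induction arbitrary: T' rule: has_type.induct)
  case (4 A \<Gamma> t B)
  from 4(3) obtain C where "T' = A \<rightarrow>\<^sub>t C" "has_type ctype (A # \<Gamma>) t C" by (rule has_type_LamE)
  then show ?case using 4(2) by blast
next
  case (5 \<Gamma> t A B u)
  from 5(5) obtain C where "has_type ctype \<Gamma> t (C \<rightarrow>\<^sub>t T')" by (rule has_type_AppE)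
  then show ?case using 5(3) by blast
qed (auto elim!: has_type_elims)

lemma has_type_append: "has_type ctype \<Gamma> t T \<Longrightarrow> has_type ctype (\<Gamma> @ \<Delta>) t T"
proof (induction rule: has_type.induct)
  case (1 i \<Gamma>)
  then show ?case using has_type.intros(1)[of i "\<Gamma> @ \<Delta>" ctype] by (simp add: nth_append)
qed (auto intro: has_type.intros)

lemma lift_closed: "has_type ctype \<Gamma> t T \<Longrightarrow> length \<Gamma> \<le> k \<Longrightarrow> lift t k = t"
  by (induction arbitrary: k rule: has_type.induct) auto

lemma bsubst_closed: "has_type ctype \<Gamma> t T \<Longrightarrow> length \<Gamma> \<le> k \<Longrightarrow> bsubst t u k = t"
  by (induction arbitrary: k u rule: has_type.induct) auto

lemma bsubst_lift [simp]: "bsubst (lift t k) u k = t"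
  by (induction t arbitrary: k u) auto

lemma beta_has_type: "beta t t' \<Longrightarrow> has_type ctype \<Gamma> t T \<Longrightarrow> has_type ctype \<Gamma> t' T"
proof (induction arbitrary: \<Gamma> T rule: beta.induct)
  case (1 A t u)
  then show ?case
    using has_type_bsubst[of ctype "A # \<Gamma>" t T "[]" A \<Gamma> u] by (auto elim!: has_type_elims)
qed (auto elim!: has_type_elims intro: has_type.intros)

lemma eta_has_type: "eta t t' \<Longrightarrow> has_type ctype \<Gamma> t T \<Longrightarrow> has_type ctype \<Gamma> t' T"
proof (induction arbitrary: \<Gamma> T rule: eta.induct)
  case (1 A t)
  then obtain B where "T = A \<rightarrow>\<^sub>t B" "has_type ctype (A # \<Gamma>) (lift t 0) (A \<rightarrow>\<^sub>t B)"
    by (auto elim!: has_type_elims)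
  then show ?case using has_type_unlift[of ctype "[]" A \<Gamma> t] by auto
qed (auto elim!: has_type_elims intro: has_type.intros)

section \<open>Conversion of open terms\<close>

text \<open>Relative to a context, because congruence under \<open>Lam\<close> moves into a larger
  context while \<open>conv\<close> covers only the empty one.\<close>

definition cstep :: "('c \<Rightarrow> 'b ty) \<Rightarrow> 'b ty list \<Rightarrow> ('b, 'c) trm \<Rightarrow> ('b, 'c) trm \<Rightarrow> bool" where
  "cstep ctype \<Gamma> t u \<longleftrightarrow> (\<exists>T. has_type ctype \<Gamma> t T \<and> has_type ctype \<Gamma> u T) \<and> (beta t u \<or> eta t u)"

definition cconv :: "('c \<Rightarrow> 'b ty) \<Rightarrow> 'b ty list \<Rightarrow> ('b, 'c) trm \<Rightarrow> ('b, 'c) trm \<Rightarrow> bool" where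
  "cconv ctype \<Gamma> = equivclp (cstep ctype \<Gamma>)"

lemma conv_eq_cconv: "conv ctype = cconv ctype []"
  by (simp add: conv_def cconv_def typed_step_def[abs_def] cstep_def[abs_def])

lemma cconv_refl [simp]: "cconv ctype \<Gamma> t t"
  by (simp add: cconv_def)

lemma cconv_sym: "cconv ctype \<Gamma> t u \<Longrightarrow> cconv ctype \<Gamma> u t"
  unfolding cconv_def by (rule equivclp_sym)

lemma cconv_trans [trans]: "cconv ctype \<Gamma> t u \<Longrightarrow> cconv ctype \<Gamma> u v \<Longrightarrow> cconv ctype \<Gamma> t v"
  unfolding cconv_def by (rule equivclp_trans)

text \<open>A conversion chain steps back and forth, and each step only asserts that some common
  type exists. Uniqueness of types gives every intermediate term the type \<open>T\<close>, so it is
  enough that \<open>h\<close> respects single steps at that type.\<close>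

lemma cconv_map:
  assumes "cconv ctype \<Gamma> t u" "has_type ctype \<Gamma> t T"
    and "\<And>t u. (beta t u \<or> eta t u) \<Longrightarrow> has_type ctype \<Gamma> t T \<Longrightarrow> has_type ctype \<Gamma> u T \<Longrightarrow>
      cconv ctype \<Delta> (h t) (h u)"
  shows "cconv ctype \<Delta> (h t) (h u)"
proof -
  have "cconv ctype \<Delta> (h t) (h u) \<and> has_type ctype \<Gamma> u T"
    using assms(1) unfolding cconv_def[of ctype \<Gamma>]
  proof (induction rule: equivclp_induct)
    case (step y z)
    then show ?case unfolding cstep_def
      by (metis assms(3) cconv_sym cconv_trans has_type_unique)
  qed (use assms(2) in simp)
  then show ?thesis ..
qed

lemma beta_cconv: "beta t u \<Longrightarrow> has_type ctype \<Gamma> t T \<Longrightarrow> cconv ctype \<Gamma> t u"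
  unfolding cconv_def by (rule r_into_equivclp) (auto simp: cstep_def intro: beta_has_type)

lemma eta_cconv: "eta t u \<Longrightarrow> has_type ctype \<Gamma> t T \<Longrightarrow> cconv ctype \<Gamma> t u"
  unfolding cconv_def by (rule r_into_equivclp) (auto simp: cstep_def intro: eta_has_type)

lemma betas_cconv:
  assumes "beta\<^sup>*\<^sup>* t u" "has_type ctype \<Gamma> t T"
  shows "cconv ctype \<Gamma> t u \<and> has_type ctype \<Gamma> u T"
  using assms by (induction rule: rtranclp_induct) (auto intro: beta_has_type cconv_trans beta_cconv)

lemma etas_cconv:
  assumes "eta\<^sup>*\<^sup>* t u" "has_type ctype \<Gamma> t T"
  shows "cconv ctype \<Gamma> t u \<and> has_type ctype \<Gamma> u T"
  using assms by (induction rule: rtranclp_induct) (auto intro: eta_has_type cconv_trans eta_cconv)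

lemma cconv_has_type:
  assumes "cconv ctype \<Gamma> t u" "has_type ctype \<Gamma> t T"
  shows "has_type ctype \<Gamma> u T"
  using assms(1) unfolding cconv_def
proof (induction rule: equivclp_induct)
  case (step y z)
  then show ?case unfolding cstep_def using has_type_unique by metis
qed (rule assms)

lemma cconv_Lam:
  assumes "cconv ctype (A # \<Gamma>) t u" "has_type ctype (A # \<Gamma>) t B"
  shows "cconv ctype \<Gamma> (Lam A t) (Lam A u)"
  using assms
  by (rule cconv_map) (metis beta.intros(4) beta_cconv eta.intros(4) eta_cconv has_type.intros(4))

lemma cconv_App:
  assumes "cconv ctype \<Gamma> t t'" "cconv ctype \<Gamma> u u'"
    and t: "has_type ctype \<Gamma> t (A \<rightarrow>\<^sub>t B)" and u: "has_type ctype \<Gamma> u A"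
  shows "cconv ctype \<Gamma> (App t u) (App t' u')"
proof -
  have "cconv ctype \<Gamma> (App t u) (App t' u)"
    using assms(1) t
    by (rule cconv_map)
      (metis u beta.intros(2) beta_cconv eta.intros(2) eta_cconv has_type.intros(5))
  also have "cconv ctype \<Gamma> (App t' u) (App t' u')"
    using assms(2) u
    by (rule cconv_map)
      (metis cconv_has_type[OF assms(1) t] beta.intros(3) beta_cconv eta.intros(3) eta_cconv has_type.intros(5))
  finally show ?thesis .
qed

text \<open>Constants are recorded along with free variables, since for superpatterns the normal
  forms have to be kept free of constants.\<close>

primrec syms :: "('b, 'c) trm \<Rightarrow> ('b fvar + 'c) set" where
  "syms (Bound i) = {}"
| "syms (Free X) = {Inl X}"
| "syms (Const c) = {Inr c}"
| "syms (Lam A t) = syms t"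
| "syms (App t u) = syms t \<union> syms u"

lemma Inl_in_syms [simp]: "Inl X \<in> syms t \<longleftrightarrow> X \<in> fvars t"
  by (induction t) auto

lemma finite_fvars [simp]: "finite (fvars t)"
  by (induction t) auto

lemma syms_lift [simp]: "syms (lift t k) = syms t"
  by (induction t arbitrary: k) auto

lemma syms_bsubst: "syms (bsubst t u k) \<subseteq> syms t \<union> syms u"
proof (induction t arbitrary: k u)
  case (Lam A t)
  then show ?case using Lam[of "lift u 0"] by auto
next
  case (App t1 t2)
  then show ?case by (simp, blast)
qed auto

lemma syms_beta: "beta t u \<Longrightarrow> syms u \<subseteq> syms t"
proof (induction rule: beta.induct)
  case (1 A t u)
  then show ?case using syms_bsubst by fastforce
qed auto

lemma syms_eta: "eta t u \<Longrightarrow> syms u = syms t"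
  by (induction rule: eta.induct) auto

lemma syms_betas: "beta\<^sup>*\<^sup>* t u \<Longrightarrow> syms u \<subseteq> syms t"
  by (induction rule: rtranclp_induct) (use syms_beta in blast)+

lemma syms_etas: "eta\<^sup>*\<^sup>* t u \<Longrightarrow> syms u = syms t"
  by (induction rule: rtranclp_induct) (use syms_eta in blast)+

section \<open>Long normal forms by hereditary substitution\<close>

lemma betas_Lam: "beta\<^sup>*\<^sup>* t u \<Longrightarrow> beta\<^sup>*\<^sup>* (Lam A t) (Lam A u)"
  by (induction rule: rtranclp_induct) (auto intro: beta.intros rtranclp.rtrancl_into_rtrancl)

lemma betas_App:
  assumes "beta\<^sup>*\<^sup>* t t'" "beta\<^sup>*\<^sup>* u u'"
  shows "beta\<^sup>*\<^sup>* (App t u) (App t' u')"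
proof -
  have "beta\<^sup>*\<^sup>* (App t u) (App t' u)"
    using assms(1)
    by (induction rule: rtranclp_induct) (auto intro: beta.intros rtranclp.rtrancl_into_rtrancl)
  also have "beta\<^sup>*\<^sup>* (App t' u) (App t' u')"
    using assms(2)
    by (induction rule: rtranclp_induct) (auto intro: beta.intros rtranclp.rtrancl_into_rtrancl)
  finally show ?thesis .
qed

lemma etas_Lam: "eta\<^sup>*\<^sup>* t u \<Longrightarrow> eta\<^sup>*\<^sup>* (Lam A t) (Lam A u)"
  by (induction rule: rtranclp_induct) (auto intro: eta.intros rtranclp.rtrancl_into_rtrancl)

lemma etas_App_right: "eta\<^sup>*\<^sup>* u u' \<Longrightarrow> eta\<^sup>*\<^sup>* (App t u) (App t u')"
  by (induction rule: rtranclp_induct) (auto intro: eta.intros rtranclp.rtrancl_into_rtrancl)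

inductive_cases long_nf_FunE: "long_nf ctype \<Gamma> t (A \<rightarrow>\<^sub>t B)"
inductive_cases long_nf_BaseE: "long_nf ctype \<Gamma> t (Base b)"

text \<open>
  Hereditary substitution: a redex created by substituting into a head position contracts at a
  type smaller than that of the substituted variable.
\<close>

lemma long_nf_bsubst:
  assumes "long_nf ctype (\<Gamma>1 @ A # \<Gamma>2) t T" "long_nf ctype (\<Gamma>1 @ \<Gamma>2) u A"
  shows "\<exists>v. long_nf ctype (\<Gamma>1 @ \<Gamma>2) v T \<and> beta\<^sup>*\<^sup>* (bsubst t u (length \<Gamma>1)) v"
  using assms
proof (induction "size A" arbitrary: A \<Gamma>1 \<Gamma>2 t T u rule: less_induct)
  case less
  note smaller = less(1)
  \<comment> \<open>A neutral term stops being neutral if its head is the replaced variable. The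
    second disjunct then keeps the type no larger than \<open>A\<close>, so the argument type of the
    next redex is strictly smaller.\<close>
  have "long_nf ctype \<Delta> t T \<Longrightarrow> \<Delta> = \<Gamma>1 @ A # \<Gamma>2 \<Longrightarrow> long_nf ctype (\<Gamma>1 @ \<Gamma>2) u A \<Longrightarrow>
      \<exists>v. long_nf ctype (\<Gamma>1 @ \<Gamma>2) v T \<and> beta\<^sup>*\<^sup>* (bsubst t u (length \<Gamma>1)) v"
    and "neutral ctype \<Delta> t T \<Longrightarrow> \<Delta> = \<Gamma>1 @ A # \<Gamma>2 \<Longrightarrow> long_nf ctype (\<Gamma>1 @ \<Gamma>2) u A \<Longrightarrow>
      \<exists>v. beta\<^sup>*\<^sup>* (bsubst t u (length \<Gamma>1)) v \<and>
        (neutral ctype (\<Gamma>1 @ \<Gamma>2) v T \<or> long_nf ctype (\<Gamma>1 @ \<Gamma>2) v T \<and> size T \<le> size A)"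
    for \<Delta> t T \<Gamma>1 u
  proof (induction arbitrary: \<Gamma>1 u and \<Gamma>1 u rule: long_nf_neutral.inducts)
    case (1 B \<Delta> t C)
    have "\<exists>v. long_nf ctype ((B # \<Gamma>1) @ \<Gamma>2) v C \<and> beta\<^sup>*\<^sup>* (bsubst t (lift u 0) (length (B # \<Gamma>1))) v"
      using 1(3,4) long_nf_neutral_lift(1)[of ctype "\<Gamma>1 @ \<Gamma>2" u A "[]" "\<Gamma>1 @ \<Gamma>2" B]
      by (intro 1(2)) auto
    then show ?case by (auto intro: long_nf_neutral.intros betas_Lam)
  next
    case (2 \<Delta> t b)
    then show ?case by (metis long_nf_neutral.intros(2))
  next
    case (3 i \<Delta>)
    show ?case
    proof (cases "i = length \<Gamma>1")
      case True
      then show ?thesis using 3 by auto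
    next
      case False
      have eq: "\<Delta> ! i = (\<Gamma>1 @ \<Gamma>2) ! (if length \<Gamma>1 < i then i - 1 else i)"
        using 3 False by (cases "i < length \<Gamma>1") (auto simp: nth_append nth_Cons' Suc_diff_Suc)
      have "neutral ctype (\<Gamma>1 @ \<Gamma>2) (bsubst (Bound i) u (length \<Gamma>1)) (\<Delta> ! i)"
        unfolding eq using 3 False long_nf_neutral.intros(3)[of _ "\<Gamma>1 @ \<Gamma>2" ctype] by auto
      then show ?thesis by blast
    qed
  next
    case (4 \<Delta> X)
    then show ?case by (auto intro: long_nf_neutral.intros)
  next
    case (5 \<Delta> c)
    then show ?case by (auto intro: long_nf_neutral.intros)
  next
    case (6 \<Delta> t B C s)
    obtain w where w: "long_nf ctype (\<Gamma>1 @ \<Gamma>2) w B" "beta\<^sup>*\<^sup>* (bsubst s u (length \<Gamma>1)) w"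
      using 6 by blast
    obtain v where v: "beta\<^sup>*\<^sup>* (bsubst t u (length \<Gamma>1)) v"
      and cases: "neutral ctype (\<Gamma>1 @ \<Gamma>2) v (B \<rightarrow>\<^sub>t C) \<or>
        long_nf ctype (\<Gamma>1 @ \<Gamma>2) v (B \<rightarrow>\<^sub>t C) \<and> size (B \<rightarrow>\<^sub>t C) \<le> size A"
      using 6 by blast
    have reds: "beta\<^sup>*\<^sup>* (bsubst (App t s) u (length \<Gamma>1)) (App v w)"
      using v w by (auto intro: betas_App)
    from cases show ?case
    proof
      assume "neutral ctype (\<Gamma>1 @ \<Gamma>2) v (B \<rightarrow>\<^sub>t C)"
      then show ?thesis using reds w(1) long_nf_neutral.intros(6) by blast
    next
      assume v': "long_nf ctype (\<Gamma>1 @ \<Gamma>2) v (B \<rightarrow>\<^sub>t C) \<and> size (B \<rightarrow>\<^sub>t C) \<le> size A"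
      then obtain v0 where v0: "v = Lam B v0" "long_nf ctype (B # \<Gamma>1 @ \<Gamma>2) v0 C"
        by (auto elim: long_nf_FunE)
      obtain x where x: "long_nf ctype (\<Gamma>1 @ \<Gamma>2) x C" "beta\<^sup>*\<^sup>* (bsubst v0 w 0) x"
        using smaller[of B "[]" "\<Gamma>1 @ \<Gamma>2" v0 C w] v' v0 w by auto
      have "beta\<^sup>*\<^sup>* (bsubst (App t s) u (length \<Gamma>1)) x"
        using reds x(2) v0(1) beta.intros(1)[of B v0 w]
        by (meson converse_rtranclp_into_rtranclp rtranclp_trans)
      then show ?thesis using x(1) v' by auto
    qed
  qed
  then show ?case using less(2,3) by blast
qed

text \<open>Induction on the type. At a function type the new bound variable is expanded at the
  argument type, and the application to that expansion is expanded at the result type.\<close>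

lemma neutral_eta_expand:
  "neutral ctype \<Gamma> t T \<Longrightarrow> \<exists>v. long_nf ctype \<Gamma> v T \<and> eta\<^sup>*\<^sup>* v t"
proof (induction T arbitrary: \<Gamma> t)
  case (Base b)
  then show ?case by (auto intro: long_nf_neutral.intros)
next
  case (Fun A B)
  have "neutral ctype (A # \<Gamma>) (Bound 0) A"
    using long_nf_neutral.intros(3)[of 0 "A # \<Gamma>" ctype] by simp
  then obtain x where x: "long_nf ctype (A # \<Gamma>) x A" "eta\<^sup>*\<^sup>* x (Bound 0)"
    using Fun(1) by blast
  have "neutral ctype (A # \<Gamma>) (App (lift t 0) x) B"
    using long_nf_neutral_lift(2)[OF Fun(3), of "[]" \<Gamma> A] x(1)
    by (auto intro: long_nf_neutral.intros)
  then obtain v where v: "long_nf ctype (A # \<Gamma>) v B" "eta\<^sup>*\<^sup>* v (App (lift t 0) x)"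
    using Fun(2) by blast
  have "eta\<^sup>*\<^sup>* v (App (lift t 0) (Bound 0))"
    using v(2) etas_App_right[OF x(2)] by (rule rtranclp_trans)
  then have "eta\<^sup>*\<^sup>* (Lam A v) t"
    using etas_Lam eta.intros(1) by (metis rtranclp.rtrancl_into_rtrancl)
  then show ?case using v(1) by (auto intro: long_nf_neutral.intros)
qed

lemma neutral_normalizes:
  assumes "neutral ctype \<Gamma> t T"
  shows "\<exists>v. long_nf ctype \<Gamma> v T \<and> cconv ctype \<Gamma> t v \<and> syms v \<subseteq> syms t"
  using neutral_eta_expand[OF assms] by (metis cconv_sym etas_cconv long_nf_has_type(1) order_refl syms_etas)

text \<open>Variables and constants need only eta-expansion. In an application the normalized
  function is an abstraction, and \<open>long_nf_bsubst\<close> contracts the redex together with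
  those it creates. Beta can only lose symbols and eta keeps them.\<close>

theorem normalization:
  "has_type ctype \<Gamma> t T \<Longrightarrow> \<exists>v. long_nf ctype \<Gamma> v T \<and> cconv ctype \<Gamma> t v \<and> syms v \<subseteq> syms t"
proof (induction rule: has_type.induct)
  case (4 A \<Gamma> t B)
  then obtain v where "long_nf ctype (A # \<Gamma>) v B" "cconv ctype (A # \<Gamma>) t v" "syms v \<subseteq> syms t"
    by blast
  then show ?case
    using cconv_Lam[OF _ 4(1)] by (intro exI[of _ "Lam A v"]) (auto intro: long_nf_neutral.intros)
next
  case (5 \<Gamma> t A B u)
  obtain v where v: "long_nf ctype \<Gamma> v (A \<rightarrow>\<^sub>t B)" "cconv ctype \<Gamma> t v" "syms v \<subseteq> syms t"
    using 5 by blast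
  obtain w where w: "long_nf ctype \<Gamma> w A" "cconv ctype \<Gamma> u w" "syms w \<subseteq> syms u"
    using 5 by blast
  obtain v0 where v0: "v = Lam A v0" "long_nf ctype (A # \<Gamma>) v0 B"
    using v(1) by (auto elim: long_nf_FunE)
  obtain x where x: "long_nf ctype \<Gamma> x B" "beta\<^sup>*\<^sup>* (bsubst v0 w 0) x"
    using long_nf_bsubst[of ctype "[]" A \<Gamma> v0 B w] v0 w by auto
  have red: "beta\<^sup>*\<^sup>* (App v w) x"
    using x(2) v0(1) beta.intros(1)[of A v0 w] by (meson converse_rtranclp_into_rtranclp)
  have "cconv ctype \<Gamma> (App t u) (App v w)"
    using v(2) w(2) 5(1,2) by (rule cconv_App)
  also have "cconv ctype \<Gamma> (App v w) x"
    using betas_cconv[OF red] v(1) w(1) by (meson has_type.intros(5) long_nf_has_type(1))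
  finally show ?case using x(1) syms_betas[OF red] v(3) w(3) by auto
qed (blast intro: neutral_normalizes long_nf_neutral.intros)+

section \<open>Substitutions\<close>

lemma is_substitutionI:
  assumes "finite (dom \<sigma>)" "\<And>X t. \<sigma> X = Some t \<Longrightarrow> long_nf ctype [] t (snd X)"
  shows "is_substitution ctype \<sigma>"
  using assms unfolding is_substitution_def by blast

lemma is_substitution_has_type:
  "is_substitution ctype \<sigma> \<Longrightarrow> has_type ctype [] (subst \<sigma> (Free X)) (snd X)"
  by (cases "\<sigma> X") (auto simp: is_substitution_def simp del: split_paired_All intro: has_type.intros long_nf_has_type)

lemma has_type_closed: "has_type ctype [] t T \<Longrightarrow> has_type ctype \<Gamma> t T"
  using has_type_append[of ctype "[]" t T \<Gamma>] by simp

lemma has_type_subst: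
  assumes "is_substitution ctype \<sigma>"
  shows "has_type ctype \<Gamma> t T \<Longrightarrow> has_type ctype \<Gamma> (subst \<sigma> t) T"
proof (induction rule: has_type.induct)
  case (2 \<Gamma> X)
  then show ?case using is_substitution_has_type[OF assms] has_type_closed by metis
qed (auto intro: has_type.intros)

lemma subst_lift:
  assumes "is_substitution ctype \<sigma>"
  shows "subst \<sigma> (lift t k) = lift (subst \<sigma> t) k"
proof (induction t arbitrary: k)
  case (Free X)
  then show ?case using is_substitution_has_type[OF assms, of X] lift_closed[of ctype "[]"] by simp
qed auto

lemma subst_bsubst:
  assumes "is_substitution ctype \<sigma>"
  shows "subst \<sigma> (bsubst t u k) = bsubst (subst \<sigma> t) (subst \<sigma> u) k"
proof (induction t arbitrary: u k)
  case (Free X)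
  then show ?case using is_substitution_has_type[OF assms, of X] bsubst_closed[of ctype "[]"] by simp
qed (auto simp: subst_lift[OF assms])

lemma beta_subst:
  assumes "is_substitution ctype \<sigma>"
  shows "beta t u \<Longrightarrow> beta (subst \<sigma> t) (subst \<sigma> u)"
  by (induction rule: beta.induct) (auto simp: subst_bsubst[OF assms] intro: beta.intros)

lemma eta_subst:
  assumes "is_substitution ctype \<sigma>"
  shows "eta t u \<Longrightarrow> eta (subst \<sigma> t) (subst \<sigma> u)"
  by (induction rule: eta.induct) (auto simp: subst_lift[OF assms] intro: eta.intros)

lemma cconv_subst:
  assumes \<sigma>: "is_substitution ctype \<sigma>" and "cconv ctype \<Gamma> t u" "has_type ctype \<Gamma> t T"
  shows "cconv ctype \<Gamma> (subst \<sigma> t) (subst \<sigma> u)"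
  using assms(2,3)
  by (rule cconv_map)
    (metis \<sigma> beta_cconv beta_subst eta_cconv eta_subst has_type_subst)

lemma cconv_closed:
  assumes "cconv ctype [] t u" "has_type ctype [] t T"
  shows "cconv ctype \<Gamma> t u"
  using assms by (rule cconv_map[where h = "\<lambda>t. t"]) (metis beta_cconv eta_cconv has_type_closed)

text \<open>The values of a substitution must be long normal forms, so arbitrary well-typed terms
  \<open>M X\<close> are normalized first.\<close>

lemma exists_substitution:
  fixes M :: "'b fvar \<Rightarrow> ('b, 'c) trm"
  assumes "finite V" "\<And>X. X \<in> V \<Longrightarrow> has_type ctype [] (M X) (snd X)"
  shows "\<exists>\<rho>. is_substitution ctype \<rho> \<and>
    (\<forall>X \<in> V. cconv ctype [] (M X) (subst \<rho> (Free X)) \<and> syms (subst \<rho> (Free X)) \<subseteq> syms (M X))"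
proof -
  have "\<forall>X \<in> V. \<exists>v. long_nf ctype [] v (snd X) \<and> cconv ctype [] (M X) v \<and> syms v \<subseteq> syms (M X)"
    using normalization assms(2) by blast
  then obtain N where N: "\<forall>X \<in> V. long_nf ctype [] (N X) (snd X) \<and> cconv ctype [] (M X) (N X) \<and> syms (N X) \<subseteq> syms (M X)"
    by metis
  let ?\<rho> = "\<lambda>X. if X \<in> V then Some (N X) else None"
  have "dom ?\<rho> = V" by (auto simp: dom_def)
  then show ?thesis
    using N assms(1) by (intro exI[of _ ?\<rho>]) (auto simp: is_substitution_def split: if_splits)
qed

lemma subst_comp_cconv:
  assumes "is_substitution ctype \<sigma>" "is_substitution ctype \<tau>" "is_substitution ctype \<rho>"
    and "\<And>X. X \<in> fvars t \<Longrightarrow> cconv ctype [] (subst \<tau> (subst \<sigma> (Free X))) (subst \<rho> (Free X))"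
    and "has_type ctype \<Gamma> t T"
  shows "cconv ctype \<Gamma> (subst \<tau> (subst \<sigma> t)) (subst \<rho> t)"
  using assms(5,4)
proof (induction rule: has_type.induct)
  case (2 \<Gamma> X)
  have "cconv ctype [] (subst \<tau> (subst \<sigma> (Free X))) (subst \<rho> (Free X))"
    using 2 by simp
  then show ?case
    by (rule cconv_closed) (rule has_type_subst[OF assms(2) is_substitution_has_type[OF assms(1)]])
next
  case (4 A \<Gamma> t B)
  then have "cconv ctype (A # \<Gamma>) (subst \<tau> (subst \<sigma> t)) (subst \<rho> t)" by simp
  then have "cconv ctype \<Gamma> (Lam A (subst \<tau> (subst \<sigma> t))) (Lam A (subst \<rho> t))"
    by (rule cconv_Lam) (rule has_type_subst[OF assms(2) has_type_subst[OF assms(1) 4(1)]])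
  then show ?case by simp
next
  case (5 \<Gamma> t A B u)
  then have "cconv ctype \<Gamma> (subst \<tau> (subst \<sigma> t)) (subst \<rho> t)"
    "cconv ctype \<Gamma> (subst \<tau> (subst \<sigma> u)) (subst \<rho> u)" by auto
  then have "cconv ctype \<Gamma> (App (subst \<tau> (subst \<sigma> t)) (subst \<tau> (subst \<sigma> u))) (App (subst \<rho> t) (subst \<rho> u))"
    by (rule cconv_App)
      (rule has_type_subst[OF assms(2) has_type_subst[OF assms(1) 5(1)]]
         has_type_subst[OF assms(2) has_type_subst[OF assms(1) 5(2)]])+
  then show ?case by simp
qed auto

text \<open>The composite substitution is prescribed only on the free variables of \<open>t\<close>,
  which keeps its domain finite.\<close>

lemma instance_trans:
  assumes "is_substitution ctype \<sigma>" "cconv ctype [] (subst \<sigma> t) u"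
    and "is_substitution ctype \<tau>" "cconv ctype [] (subst \<tau> u) v" and t: "has_type ctype [] t T"
  shows "\<exists>\<rho>. is_substitution ctype \<rho> \<and> cconv ctype [] (subst \<rho> t) v"
proof -
  have "\<And>X. has_type ctype [] (subst \<tau> (subst \<sigma> (Free X))) (snd X)"
    using assms has_type_subst is_substitution_has_type by metis
  then obtain \<rho> where \<rho>: "is_substitution ctype \<rho>"
    "\<And>X. X \<in> fvars t \<Longrightarrow> cconv ctype [] (subst \<tau> (subst \<sigma> (Free X))) (subst \<rho> (Free X))"
    using exists_substitution[of "fvars t" ctype "\<lambda>X. subst \<tau> (subst \<sigma> (Free X))"] by auto
  have "cconv ctype [] (subst \<rho> t) (subst \<tau> (subst \<sigma> t))"
    using subst_comp_cconv[OF assms(1,3) \<rho> t] cconv_sym by blast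
  also have "cconv ctype [] (subst \<tau> (subst \<sigma> t)) (subst \<tau> u)"
    using assms(3,2) has_type_subst[OF assms(1) t] by (rule cconv_subst)
  also note assms(4)
  finally show ?thesis using \<rho> by blast
qed

section \<open>A finite model\<close>

text \<open>
  The full type hierarchy over \<open>{0..N}\<close> at every base type. All elements are natural numbers, a
  function being coded by its graph, so that a single HOL type carries all levels.
\<close>

definition graph_code :: "nat set \<Rightarrow> (nat \<Rightarrow> nat) \<Rightarrow> nat" where
  "graph_code D h = set_encode ((\<lambda>d. prod_encode (d, h d)) ` D)"

definition apply_code :: "nat \<Rightarrow> nat \<Rightarrow> nat" where
  "apply_code a d = (THE v. prod_encode (d, v) \<in> set_decode a)"

primrec dom_ty :: "nat \<Rightarrow> 'b ty \<Rightarrow> nat set" where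
  "dom_ty N (Base b) = {0..N}"
| "dom_ty N (A \<rightarrow>\<^sub>t B) = {graph_code (dom_ty N A) h |h. h ` dom_ty N A \<subseteq> dom_ty N B}"

lemma finite_dom_ty [simp]: "finite (dom_ty N A)"
proof (induction A)
  case (Fun A B)
  have "dom_ty N (A \<rightarrow>\<^sub>t B) \<subseteq> set_encode ` Pow (prod_encode ` (dom_ty N A \<times> dom_ty N B))"
    by (auto simp: graph_code_def)
  moreover have "finite (set_encode ` Pow (prod_encode ` (dom_ty N A \<times> dom_ty N B)))"
    using Fun by simp
  ultimately show ?case by (rule finite_subset)
qed simp

lemma apply_graph_code [simp]: "finite D \<Longrightarrow> d \<in> D \<Longrightarrow> apply_code (graph_code D h) d = h d"
  by (auto simp: apply_code_def graph_code_def set_encode_inverse)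

lemma graph_code_cong: "(\<And>d. d \<in> D \<Longrightarrow> h d = h' d) \<Longrightarrow> graph_code D h = graph_code D h'"
  by (auto simp: graph_code_def intro!: arg_cong[of _ _ set_encode] image_cong)

lemma graph_code_in_dom [intro]:
  "(\<And>d. d \<in> dom_ty N A \<Longrightarrow> h d \<in> dom_ty N B) \<Longrightarrow> graph_code (dom_ty N A) h \<in> dom_ty N (A \<rightarrow>\<^sub>t B)"
  by auto

lemma apply_code_in_dom [intro]: "a \<in> dom_ty N (A \<rightarrow>\<^sub>t B) \<Longrightarrow> d \<in> dom_ty N A \<Longrightarrow> apply_code a d \<in> dom_ty N B"
  by auto

text \<open>Extensionality: a code contains nothing beyond the graph on the domain. This makes eta
  sound in the model.\<close>

lemma graph_code_apply: "a \<in> dom_ty N (A \<rightarrow>\<^sub>t B) \<Longrightarrow> graph_code (dom_ty N A) (apply_code a) = a"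
  by (auto intro: graph_code_cong)

declare dom_ty.simps(2) [simp del]

primrec sem :: "nat \<Rightarrow> ('c \<Rightarrow> nat) \<Rightarrow> ('b fvar \<Rightarrow> nat) \<Rightarrow> nat list \<Rightarrow> ('b, 'c) trm \<Rightarrow> nat" where
  "sem N J I env (Bound i) = env ! i"
| "sem N J I env (Free X) = I X"
| "sem N J I env (Const c) = J c"
| "sem N J I env (Lam A t) = graph_code (dom_ty N A) (\<lambda>d. sem N J I (d # env) t)"
| "sem N J I env (App t u) = apply_code (sem N J I env t) (sem N J I env u)"

definition valid_env :: "nat \<Rightarrow> nat list \<Rightarrow> 'b ty list \<Rightarrow> bool" where
  "valid_env N env \<Gamma> \<longleftrightarrow> list_all2 (\<lambda>d A. d \<in> dom_ty N A) env \<Gamma>"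

lemma valid_env_simps [simp]:
  "valid_env N [] []"
  "valid_env N (d # env) (A # \<Gamma>) \<longleftrightarrow> d \<in> dom_ty N A \<and> valid_env N env \<Gamma>"
  by (auto simp: valid_env_def)

lemma sem_lift: "sem N J I (e1 @ d # e2) (lift t (length e1)) = sem N J I (e1 @ e2) t"
proof (induction t arbitrary: e1)
  case (Bound i)
  then show ?case by (auto simp: nth_append Suc_diff_le)
next
  case (Lam A t)
  have "sem N J I (x # e1 @ d # e2) (lift t (Suc (length e1))) = sem N J I (x # e1 @ e2) t" for x
    using Lam[of "x # e1"] by simp
  then show ?case by simp
qed simp_all

lemma sem_bsubst:
  "sem N J I (e1 @ e2) (bsubst t u (length e1)) = sem N J I (e1 @ sem N J I (e1 @ e2) u # e2) t"
proof (induction t arbitrary: e1 u)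
  case (Bound i)
  then show ?case by (cases "i < length e1") (auto simp: nth_append nth_Cons' Suc_diff_Suc)
next
  case (Lam A t)
  have "sem N J I (x # e1 @ e2) (bsubst t (lift u 0) (Suc (length e1)))
      = sem N J I (x # e1 @ sem N J I (e1 @ e2) u # e2) t" for x
    using Lam[of "x # e1" "lift u 0"] sem_lift[of N J I "[]" x "e1 @ e2" u] by simp
  then show ?case by simp
qed simp_all

lemma sem_append: "has_type ctype \<Gamma> t T \<Longrightarrow> length e = length \<Gamma> \<Longrightarrow> sem N J I (e @ e') t = sem N J I e t"
proof (induction arbitrary: e rule: has_type.induct)
  case (4 A \<Gamma> t B)
  have "sem N J I (x # e @ e') t = sem N J I (x # e) t" for x
    using 4(2)[of "x # e"] 4(3) by simp
  then show ?case by simp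
qed (simp_all add: nth_append)

section \<open>Soundness of conversion in the model\<close>

locale model =
  fixes ctype :: "'c \<Rightarrow> 'b ty" and N :: nat and J :: "'c \<Rightarrow> nat" and I :: "'b fvar \<Rightarrow> nat"
  assumes J: "J c \<in> dom_ty N (ctype c)" and I: "I X \<in> dom_ty N (snd X)"
begin

lemma sem_in_dom: "has_type ctype \<Gamma> t T \<Longrightarrow> valid_env N env \<Gamma> \<Longrightarrow> sem N J I env t \<in> dom_ty N T"
  by (induction arbitrary: env rule: has_type.induct)
    (auto simp: J I valid_env_def dest: list_all2_nthD2)

lemma sem_beta:
  "beta t u \<Longrightarrow> has_type ctype \<Gamma> t T \<Longrightarrow> valid_env N env \<Gamma> \<Longrightarrow> sem N J I env t = sem N J I env u"
proof (induction arbitrary: \<Gamma> T env rule: beta.induct)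
  case (1 A t u)
  then have "sem N J I env u \<in> dom_ty N A"
    by (auto elim!: has_type_elims intro: sem_in_dom)
  then show ?case using sem_bsubst[of N J I "[]" env t u] by simp
next
  case (4 t t' A)
  then obtain B where "has_type ctype (A # \<Gamma>) t B" by (auto elim!: has_type_elims)
  then show ?case using 4(2,4) by (auto intro!: graph_code_cong)
qed (fastforce elim!: has_type_elims)+

lemma sem_eta:
  "eta t u \<Longrightarrow> has_type ctype \<Gamma> t T \<Longrightarrow> valid_env N env \<Gamma> \<Longrightarrow> sem N J I env t = sem N J I env u"
proof (induction arbitrary: \<Gamma> T env rule: eta.induct)
  case (1 A t)
  obtain B where "T = A \<rightarrow>\<^sub>t B" "has_type ctype \<Gamma> t (A \<rightarrow>\<^sub>t B)"
    using 1(1) eta_has_type[OF eta.intros(1) 1(1)] by (auto elim!: has_type_LamE)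
  then have "sem N J I env t \<in> dom_ty N (A \<rightarrow>\<^sub>t B)"
    using 1(2) sem_in_dom by blast
  moreover have "sem N J I (d # env) (lift t 0) = sem N J I env t" for d
    using sem_lift[of N J I "[]" d env t] by simp
  ultimately show ?case using graph_code_apply by simp
next
  case (4 t t' A)
  then obtain B where "has_type ctype (A # \<Gamma>) t B" by (auto elim!: has_type_elims)
  then show ?case using 4(2,4) by (auto intro!: graph_code_cong)
qed (fastforce elim!: has_type_elims)+

lemma sem_cconv:
  assumes "cconv ctype \<Gamma> t u" "valid_env N env \<Gamma>"
  shows "sem N J I env t = sem N J I env u"
  using assms(1) unfolding cconv_def
proof (induction rule: equivclp_induct)
  case (step y z)
  then show ?case unfolding cstep_def using assms(2) sem_beta sem_eta by metis
qed simp

lemma sem_closed: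
  assumes "has_type ctype [] t T"
  shows "sem N J I env t = sem N J I [] t"
  using sem_append[OF assms, of "[]"] by simp

text \<open>Substitution turns into a change of the interpretation of free variables. The empty
  environment suffices for the values, because terms in the range of a substitution have no loose
  indices.\<close>

lemma sem_subst:
  assumes \<sigma>: "is_substitution ctype \<sigma>"
    and "\<And>X. X \<in> fvars t \<Longrightarrow> sem N J I [] (subst \<sigma> (Free X)) = I' X"
  shows "sem N J I env (subst \<sigma> t) = sem N J I' env t"
  using assms(2)
proof (induction t arbitrary: env)
  case (Free X)
  have "sem N J I env (subst \<sigma> (Free X)) = sem N J I [] (subst \<sigma> (Free X))"
    using is_substitution_has_type[OF \<sigma>] by (rule sem_closed)
  then show ?case using Free by simp
qed auto

lemma subst_model:
  assumes "is_substitution ctype \<sigma>"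
  shows "model ctype N J (\<lambda>X. sem N J I [] (subst \<sigma> (Free X)))"
  by standard (auto intro: J sem_in_dom[of "[]"] is_substitution_has_type[OF assms] simp del: subst.simps)

end

text \<open>The hereditarily constant element with the top value \<open>N\<close>. Applying it gives
  junk again, so a head interpreted by it hides all its arguments.\<close>

primrec junk :: "nat \<Rightarrow> 'b ty \<Rightarrow> nat" where
  "junk N (Base b) = N"
| "junk N (A \<rightarrow>\<^sub>t B) = graph_code (dom_ty N A) (\<lambda>_. junk N B)"

lemma junk_in_dom [simp]: "junk N T \<in> dom_ty N T"
  by (induction T) auto

section \<open>The generalization problem\<close>

text \<open>The Boolean names a side: \<open>True\<close> for first arguments and x,
  \<open>False\<close> for second arguments and y. One proof then serves both branches.\<close>

definition sel :: "bool \<Rightarrow> 'a \<Rightarrow> 'a \<Rightarrow> 'a" where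
  "sel d u v = (if d then u else v)"

lemma sel_simps [simp]: "sel True u v = u" "sel False u v = v"
  by (simp_all add: sel_def)

locale unary_constant =
  fixes ctype :: "'c \<Rightarrow> 'b ty" and \<alpha> :: 'b and f :: 'c
  assumes f: "ctype f = Base \<alpha> \<rightarrow>\<^sub>t Base \<alpha>"
begin

abbreviation "xy \<equiv> [Base \<alpha>, Base \<alpha>]"

text \<open>The variable Y, with a copy for every base type because \<open>combine\<close> may end
  in any of them.\<close>

definition pair_var :: "'b \<Rightarrow> 'b fvar" where
  "pair_var \<beta> = (0, Base \<beta> \<rightarrow>\<^sub>t Base \<beta> \<rightarrow>\<^sub>t Base \<beta>)"

definition base_var :: "'b \<Rightarrow> 'b fvar" where
  "base_var \<beta> = (1, Base \<beta>)"

definition unary_var :: "'b fvar" where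
  "unary_var = (2, Base \<alpha> \<rightarrow>\<^sub>t Base \<alpha>)"

lemma snd_vars [simp]:
  "snd (pair_var \<beta>) = Base \<beta> \<rightarrow>\<^sub>t Base \<beta> \<rightarrow>\<^sub>t Base \<beta>"
  "snd (base_var \<beta>) = Base \<beta>"
  "snd unary_var = Base \<alpha> \<rightarrow>\<^sub>t Base \<alpha>"
  by (simp_all add: pair_var_def base_var_def unary_var_def)

lemma vars_distinct [simp]:
  "pair_var \<beta> \<noteq> base_var \<gamma>" "base_var \<gamma> \<noteq> pair_var \<beta>"
  "pair_var \<beta> \<noteq> unary_var" "unary_var \<noteq> pair_var \<beta>"
  "base_var \<gamma> \<noteq> unary_var" "unary_var \<noteq> base_var \<gamma>"
  "pair_var \<beta> = pair_var \<gamma> \<longleftrightarrow> \<beta> = \<gamma>"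
  by (auto simp: pair_var_def base_var_def unary_var_def)

abbreviation Y :: "'b \<Rightarrow> ('b, 'c) trm \<Rightarrow> ('b, 'c) trm \<Rightarrow> ('b, 'c) trm" where
  "Y \<beta> p q \<equiv> App (App (Free (pair_var \<beta>)) p) q"

abbreviation P :: "('b, 'c) trm \<Rightarrow> ('b, 'c) trm" where
  "P p \<equiv> App (Free unary_var) p"

definition G :: "('b, 'c) trm \<Rightarrow> ('b, 'c) trm" where
  "G r = Lam (Base \<alpha>) (Lam (Base \<alpha>) (App (Const f) r))"

lemma has_type_Free: "snd X = T \<Longrightarrow> has_type ctype \<Gamma> (Free X) T"
  using has_type.intros(2) by blast

lemma neutral_Free: "snd X = T \<Longrightarrow> neutral ctype \<Gamma> (Free X) T"
  using long_nf_neutral.intros(4) by blast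

lemma has_type_f: "has_type ctype \<Gamma> (Const f) (Base \<alpha> \<rightarrow>\<^sub>t Base \<alpha>)"
  using has_type.intros(3)[of ctype \<Gamma> f] f by simp

lemma neutral_f: "neutral ctype \<Gamma> (Const f) (Base \<alpha> \<rightarrow>\<^sub>t Base \<alpha>)"
  using long_nf_neutral.intros(5)[of ctype \<Gamma> f] f by simp

lemma has_type_Y_iff [simp]:
  "has_type ctype \<Gamma> (Y \<beta> p q) T \<longleftrightarrow> T = Base \<beta> \<and> has_type ctype \<Gamma> p (Base \<beta>) \<and> has_type ctype \<Gamma> q (Base \<beta>)"
  by (auto elim!: has_type_elims intro!: has_type.intros(5) has_type_Free)

lemma has_type_P_iff [simp]:
  "has_type ctype \<Gamma> (P p) T \<longleftrightarrow> T = Base \<alpha> \<and> has_type ctype \<Gamma> p (Base \<alpha>)"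
  by (auto elim!: has_type_elims intro!: has_type.intros(5) has_type_Free)

lemma has_type_f_iff [simp]:
  "has_type ctype \<Gamma> (App (Const f) p) T \<longleftrightarrow> T = Base \<alpha> \<and> has_type ctype \<Gamma> p (Base \<alpha>)"
  by (auto simp: f elim!: has_type_elims intro!: has_type.intros(5) has_type_f)

lemma has_type_G [simp]:
  "has_type ctype xy r (Base \<alpha>) \<Longrightarrow> has_type ctype [] (G r) (Base \<alpha> \<rightarrow>\<^sub>t Base \<alpha> \<rightarrow>\<^sub>t Base \<alpha>)"
  by (auto simp: G_def intro!: has_type.intros(4))

lemma long_nf_G [simp]:
  "long_nf ctype xy r (Base \<alpha>) \<Longrightarrow> long_nf ctype [] (G r) (Base \<alpha> \<rightarrow>\<^sub>t Base \<alpha> \<rightarrow>\<^sub>t Base \<alpha>)"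
  unfolding G_def by (intro long_nf_neutral.intros(1,2,6)) (auto intro: neutral_f)

lemma subst_G [simp]: "subst \<sigma> (G r) = G (subst \<sigma> r)"
  by (simp add: G_def)

lemma cconv_G:
  assumes "cconv ctype xy r r'" "has_type ctype xy r (Base \<alpha>)"
  shows "cconv ctype [] (G r) (G r')"
  unfolding G_def
  by (intro cconv_Lam cconv_App[OF _ assms(1) has_type_f assms(2)] cconv_refl)
    (use assms in \<open>auto intro!: has_type.intros(4)\<close>)

lemma long_nf_YP:
  "long_nf ctype \<Gamma> p (Base \<beta>) \<Longrightarrow> long_nf ctype \<Gamma> q (Base \<beta>) \<Longrightarrow> long_nf ctype \<Gamma> (Y \<beta> p q) (Base \<beta>)"
  "long_nf ctype \<Gamma> p' (Base \<alpha>) \<Longrightarrow> long_nf ctype \<Gamma> (P p') (Base \<alpha>)"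
  by (auto intro!: long_nf_neutral.intros(2,6) neutral_Free)

lemma long_nf_Bound: "i < length \<Gamma> \<Longrightarrow> \<Gamma> ! i = Base \<beta> \<Longrightarrow> long_nf ctype \<Gamma> (Bound i) (Base \<beta>)"
  by (metis long_nf_neutral.intros(2,3))

section \<open>Shapes of long normal forms of base type\<close>

text \<open>These heads are exactly the ones that \<open>spec_I\<close> and \<open>spec_J\<close>
  interpret by \<open>junk\<close>.\<close>

inductive junky :: "('b, 'c) trm \<Rightarrow> bool" where
  "c \<noteq> f \<Longrightarrow> junky (Const c)"
| "X \<notin> range pair_var \<Longrightarrow> X \<noteq> unary_var \<Longrightarrow> junky (Free X)"
| "junky t \<Longrightarrow> junky (App t u)"

inductive_cases neutral_AppE: "neutral ctype \<Gamma> (App t u) T"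
inductive_cases neutral_LamE: "neutral ctype \<Gamma> (Lam A t) T"
inductive_cases neutral_BoundE: "neutral ctype \<Gamma> (Bound i) T"
inductive_cases neutral_FreeE: "neutral ctype \<Gamma> (Free X) T"
inductive_cases neutral_ConstE: "neutral ctype \<Gamma> (Const c) T"

text \<open>Bound variables of base type take no arguments, so an application that is not junky is
  headed by Y, P or f. Partial applications are listed because the induction passes through
  them.\<close>

lemma neutral_shape:
  assumes "neutral ctype \<Gamma> t T" "set \<Gamma> \<subseteq> range Base"
  shows "(\<exists>i < length \<Gamma>. t = Bound i \<and> T = \<Gamma> ! i) \<or>
    (\<exists>\<beta>. t = Free (pair_var \<beta>) \<and> T = Base \<beta> \<rightarrow>\<^sub>t Base \<beta> \<rightarrow>\<^sub>t Base \<beta>) \<or>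
    (\<exists>\<beta> p. t = App (Free (pair_var \<beta>)) p \<and> T = Base \<beta> \<rightarrow>\<^sub>t Base \<beta> \<and> long_nf ctype \<Gamma> p (Base \<beta>)) \<or>
    (\<exists>\<beta> p q. t = Y \<beta> p q \<and> T = Base \<beta> \<and> long_nf ctype \<Gamma> p (Base \<beta>) \<and> long_nf ctype \<Gamma> q (Base \<beta>)) \<or>
    (t = Free unary_var \<or> t = Const f) \<and> T = Base \<alpha> \<rightarrow>\<^sub>t Base \<alpha> \<or>
    (\<exists>p. (t = P p \<or> t = App (Const f) p) \<and> T = Base \<alpha> \<and> long_nf ctype \<Gamma> p (Base \<alpha>)) \<or>
    junky t"
  using assms(1)
proof (induction t arbitrary: T)
  case (Bound i)
  then show ?case by (auto elim: neutral_BoundE)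
next
  case (Free X)
  then show ?case by (auto elim!: neutral_FreeE intro: junky.intros)
next
  case (Const c)
  then show ?case using f by (auto elim!: neutral_ConstE intro: junky.intros)
next
  case (Lam A t)
  then show ?case by (auto elim: neutral_LamE)
next
  case (App t u)
  from App(3) obtain A where A: "neutral ctype \<Gamma> t (A \<rightarrow>\<^sub>t T)" "long_nf ctype \<Gamma> u A"
    by (auto elim: neutral_AppE)
  have "\<Gamma> ! i \<noteq> A \<rightarrow>\<^sub>t T" if "i < length \<Gamma>" for i
    using assms(2) nth_mem[OF that] by auto
  then show ?case using App(1)[OF A(1)] A(2) junky.intros(3)[of t u] by fastforce
qed

lemma long_nf_base_cases [consumes 2, case_names Bound Y P f junky]:
  assumes "long_nf ctype \<Gamma> t (Base \<beta>)" "set \<Gamma> \<subseteq> range Base"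
  obtains i where "i < length \<Gamma>" "t = Bound i" "\<Gamma> ! i = Base \<beta>"
  | p q where "t = Y \<beta> p q" "long_nf ctype \<Gamma> p (Base \<beta>)" "long_nf ctype \<Gamma> q (Base \<beta>)"
  | p where "t = P p" "\<beta> = \<alpha>" "long_nf ctype \<Gamma> p (Base \<alpha>)"
  | p where "t = App (Const f) p" "\<beta> = \<alpha>" "long_nf ctype \<Gamma> p (Base \<alpha>)"
  | "junky t"
proof -
  have "neutral ctype \<Gamma> t (Base \<beta>)" using assms(1) by (auto elim: long_nf_BaseE)
  from neutral_shape[OF this assms(2)] show ?thesis
    using that by fastforce
qed

text \<open>All base types share the carrier \<open>{0..N}\<close>, so a single operation
  \<open>yf\<close> can interpret every copy of Y.\<close>

definition spec_I :: "nat \<Rightarrow> (nat \<Rightarrow> nat \<Rightarrow> nat) \<Rightarrow> (nat \<Rightarrow> nat) \<Rightarrow> 'b fvar \<Rightarrow> nat" where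
  "spec_I N yf pf X =
     (if X \<in> range pair_var then graph_code {0..N} (\<lambda>u. graph_code {0..N} (yf u))
      else if X = unary_var then graph_code {0..N} pf
      else junk N (snd X))"

definition spec_J :: "nat \<Rightarrow> (nat \<Rightarrow> nat) \<Rightarrow> 'c \<Rightarrow> nat" where
  "spec_J N ff c = (if c = f then graph_code {0..N} ff else junk N (ctype c))"

abbreviation "S N yf pf ff \<equiv> sem N (spec_J N ff) (spec_I N yf pf)"

definition bounded_ops :: "nat \<Rightarrow> (nat \<Rightarrow> nat \<Rightarrow> nat) \<Rightarrow> (nat \<Rightarrow> nat) \<Rightarrow> (nat \<Rightarrow> nat) \<Rightarrow> bool" where
  "bounded_ops N yf pf ff \<longleftrightarrow>
     (\<forall>u \<le> N. \<forall>v \<le> N. yf u v \<le> N) \<and> (\<forall>u \<le> N. pf u \<le> N) \<and> (\<forall>u \<le> N. ff u \<le> N)"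

lemma graph_code_base:
  "(\<And>u. u \<le> N \<Longrightarrow> h u \<in> dom_ty N B) \<Longrightarrow> graph_code {0..N} h \<in> dom_ty N (Base \<beta> \<rightarrow>\<^sub>t B)"
  using graph_code_in_dom[of N "Base \<beta>" h B] by simp

lemma spec_J_in_dom:
  assumes "\<And>u. u \<le> N \<Longrightarrow> ff u \<le> N"
  shows "spec_J N ff c \<in> dom_ty N (ctype c)"
proof (cases "c = f")
  case True
  have "graph_code {0..N} ff \<in> dom_ty N (Base \<alpha> \<rightarrow>\<^sub>t Base \<alpha>)"
    using assms by (intro graph_code_base) simp
  then show ?thesis using True f by (simp add: spec_J_def)
qed (simp add: spec_J_def)

lemma spec_model:
  assumes "bounded_ops N yf pf ff"
  shows "model ctype N (spec_J N ff) (spec_I N yf pf)"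
proof
  fix c
  show "spec_J N ff c \<in> dom_ty N (ctype c)"
    using assms by (intro spec_J_in_dom) (simp add: bounded_ops_def)
next
  fix X
  consider \<beta> where "X = pair_var \<beta>" | "X = unary_var" | "X \<notin> range pair_var" "X \<noteq> unary_var"
    by blast
  then show "spec_I N yf pf X \<in> dom_ty N (snd X)"
  proof cases
    case 1
    have "graph_code {0..N} (\<lambda>u. graph_code {0..N} (yf u)) \<in> dom_ty N (Base \<beta> \<rightarrow>\<^sub>t Base \<beta> \<rightarrow>\<^sub>t Base \<beta>)"
      using assms by (intro graph_code_base) (simp add: bounded_ops_def)
    then show ?thesis using 1 by (simp add: spec_I_def)
  next
    case 2
    have "graph_code {0..N} pf \<in> dom_ty N (Base \<alpha> \<rightarrow>\<^sub>t Base \<alpha>)"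
      using assms by (intro graph_code_base) (simp add: bounded_ops_def)
    then show ?thesis using 2 by (auto simp: spec_I_def)
  qed (simp add: spec_I_def)
qed

lemma junk_model:
  assumes "bounded_ops N yf pf ff"
  shows "model ctype N (spec_J N ff) (\<lambda>X. junk N (snd X))"
proof
  fix c
  show "spec_J N ff c \<in> dom_ty N (ctype c)"
    using assms by (intro spec_J_in_dom) (simp add: bounded_ops_def)
qed simp

context
  fixes N yf pf ff
  assumes ops: "bounded_ops N yf pf ff"
begin

interpretation spec: model ctype N "spec_J N ff" "spec_I N yf pf"
  using ops by (rule spec_model)

lemma sem_base_le: "has_type ctype \<Gamma> t (Base \<beta>) \<Longrightarrow> valid_env N env \<Gamma> \<Longrightarrow> S N yf pf ff env t \<le> N"
  using spec.sem_in_dom[of \<Gamma> t "Base \<beta>" env] by simp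

lemma junky_sem:
  "junky t \<Longrightarrow> has_type ctype \<Gamma> t T \<Longrightarrow> valid_env N env \<Gamma> \<Longrightarrow> S N yf pf ff env t = junk N T"
proof (induction arbitrary: T rule: junky.induct)
  case (3 t u)
  from 3(3) obtain A where "has_type ctype \<Gamma> t (A \<rightarrow>\<^sub>t T)" "has_type ctype \<Gamma> u A"
    by (auto elim: has_type_AppE)
  then show ?case using 3(2)[of "A \<rightarrow>\<^sub>t T"] 3(4) spec.sem_in_dom[of \<Gamma> u A env] by simp
qed (auto simp: spec_J_def spec_I_def elim!: has_type_elims)

lemma sem_Y:
  assumes "has_type ctype \<Gamma> p (Base \<beta>)" "has_type ctype \<Gamma> q (Base \<beta>)" "valid_env N env \<Gamma>"
  shows "S N yf pf ff env (Y \<beta> p q) = yf (S N yf pf ff env p) (S N yf pf ff env q)"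
  using assms sem_base_le by (simp add: spec_I_def)

lemma sem_P:
  assumes "has_type ctype \<Gamma> p (Base \<beta>)" "valid_env N env \<Gamma>"
  shows "S N yf pf ff env (P p) = pf (S N yf pf ff env p)"
  using assms sem_base_le by (simp add: spec_I_def image_iff)

lemma sem_f:
  assumes "has_type ctype \<Gamma> p (Base \<beta>)" "valid_env N env \<Gamma>"
  shows "S N yf pf ff env (App (Const f) p) = ff (S N yf pf ff env p)"
  using assms sem_base_le by (simp add: spec_J_def)

end

text \<open>Applying both values to x and then to y peels off the binders. The inner binder is y,
  hence the environment \<open>[y, x]\<close>.\<close>

lemma sem_G_eqD:
  assumes "sem N (spec_J N ff) I [] (G r) = sem N (spec_J N ff) I' [] (G r')" "x \<le> N" "y \<le> N"
    and "sem N (spec_J N ff) I [y, x] r \<le> N" "sem N (spec_J N ff) I' [y, x] r' \<le> N"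
  shows "ff (sem N (spec_J N ff) I [y, x] r) = ff (sem N (spec_J N ff) I' [y, x] r')"
proof -
  have "apply_code (apply_code (sem N (spec_J N ff) I [] (G r)) x) y
      = apply_code (apply_code (sem N (spec_J N ff) I' [] (G r')) x) y"
    using assms(1) by simp
  then show ?thesis using assms(2-) by (simp add: G_def spec_J_def)
qed

subsection \<open>Weights\<close>

text \<open>Truncation keeps the values inside the finite model and makes \<open>N\<close>
  absorbing, so that junk acts as an infinite weight.\<close>

definition wY :: "nat \<Rightarrow> nat \<Rightarrow> bool \<Rightarrow> nat \<Rightarrow> nat \<Rightarrow> nat" where
  "wY N a d u v = min N (a + sel d u v)"

definition wP :: "nat \<Rightarrow> nat \<Rightarrow> nat \<Rightarrow> nat" where
  "wP N b u = min N (b + u)"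

lemma bounded_weights [simp]: "bounded_ops N (wY N a d) (wP N b) (wP N c)"
  by (simp add: bounded_ops_def wY_def wP_def)

text \<open>Evaluation follows a single path, taking side \<open>d\<close> at each Y and the sole
  argument at P and f, and adds the weights it meets. The path does not depend on the environment
  and ends in a bound variable or a junky subterm.\<close>

lemma weight_form:
  assumes "long_nf ctype \<Gamma> t (Base \<beta>)" "set \<Gamma> \<subseteq> range Base" "\<Gamma> \<noteq> []"
  shows "\<exists>m i. i < length \<Gamma> \<and> (\<forall>env. valid_env N env \<Gamma> \<longrightarrow>
    S N (wY N a d) (wP N b) (wP N c) env t = min N (m + env ! i))"
  using assms(1)
proof (induction "size t" arbitrary: t \<beta> rule: less_induct)
  case less
  let ?S = "S N (wY N a d) (wP N b) (wP N c)"
  from less(2) assms(2) show ?case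
  proof (cases rule: long_nf_base_cases)
    case (Bound i)
    have "env ! i \<le> N" if "valid_env N env \<Gamma>" for env
      using list_all2_nthD2[OF that[unfolded valid_env_def] Bound(1)] Bound(3) by simp
    then show ?thesis using Bound by (intro exI[of _ 0] exI[of _ i]) auto
  next
    case (Y p q)
    have pq: "long_nf ctype \<Gamma> (sel d p q) (Base \<beta>)" "size (sel d p q) < size t"
      using Y by (cases d; simp)+
    obtain m i where mi: "i < length \<Gamma>" "\<And>env. valid_env N env \<Gamma> \<Longrightarrow> ?S env (sel d p q) = min N (m + env ! i)"
      using less(1)[OF pq(2,1)] by blast
    have "?S env t = min N (a + m + env ! i)" if "valid_env N env \<Gamma>" for env
      using mi(2)[OF that] Y(1)
        sem_Y[OF bounded_weights long_nf_has_type(1)[OF Y(2)] long_nf_has_type(1)[OF Y(3)] that]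
      by (cases d) (auto simp: wY_def simp del: sem.simps)
    then show ?thesis using mi(1) by blast
  next
    case (P p)
    obtain m i where mi: "i < length \<Gamma>" "\<And>env. valid_env N env \<Gamma> \<Longrightarrow> ?S env p = min N (m + env ! i)"
      using less(1)[OF _ P(3)] P(1) by auto
    have "?S env t = min N (b + m + env ! i)" if "valid_env N env \<Gamma>" for env
      using mi(2)[OF that] P that sem_P[OF bounded_weights long_nf_has_type(1)[OF P(3)] that]
      by (simp add: wP_def del: sem.simps)
    then show ?thesis using mi(1) by blast
  next
    case (f p)
    obtain m i where mi: "i < length \<Gamma>" "\<And>env. valid_env N env \<Gamma> \<Longrightarrow> ?S env p = min N (m + env ! i)"
      using less(1)[OF _ f(3)] f(1) by auto
    have "?S env t = min N (c + m + env ! i)" if "valid_env N env \<Gamma>" for env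
      using mi(2)[OF that] f that sem_f[OF bounded_weights long_nf_has_type(1)[OF f(3)] that]
      by (simp add: wP_def del: sem.simps)
    then show ?thesis using mi(1) by blast
  next
    case junky
    \<comment> \<open>Junk has value \<open>N\<close>. The weight \<open>N\<close> saturates the sum
      whatever the index, and index 0 exists because the context is nonempty.\<close>
    then have "?S env t = min N (N + env ! 0)" if "valid_env N env \<Gamma>" for env
      using junky_sem[OF bounded_weights _ long_nf_has_type(1)[OF less(2)] that] by simp
    then show ?thesis using assms(3) by blast
  qed
qed

text \<open>
  \<open>spine True m n r\<close>: following first arguments of \<open>Y\<close> and arguments of \<open>P\<close> from the root of
  \<open>r\<close> leads to \<open>x\<close> (index 1) after \<open>m\<close> occurrences of \<open>Y\<close> and \<open>n\<close> of \<open>P\<close>; \<open>spine False\<close>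
  follows second arguments to \<open>y\<close> (index 0).
\<close>

inductive spine :: "bool \<Rightarrow> nat \<Rightarrow> nat \<Rightarrow> ('b, 'c) trm \<Rightarrow> bool" for d where
  "spine d 0 0 (Bound (sel d 1 0))"
| "spine d m n (sel d p q) \<Longrightarrow> spine d (Suc m) n (Y \<alpha> p q)"
| "spine d m n p \<Longrightarrow> spine d m (Suc n) (P p)"

text \<open>The environment gives 0 to the target variable and 2 to the other one. A zero value
  excludes f, which costs 1, as well as the wrong variable and junk, both worth 2, so the path is a
  spine. The equation \<open>n * b = 0\<close> says that P is absent from it once P has positive
  weight.\<close>

lemma exists_spine:
  assumes "long_nf ctype xy r (Base \<alpha>)"
    and "S 2 (wY 2 0 d) (wP 2 b) (wP 2 1) (sel d [2, 0] [0, 2]) r = 0"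
  shows "\<exists>m n. spine d m n r \<and> n * b = 0"
  using assms
proof (induction "size r" arbitrary: r rule: less_induct)
  case less
  let ?S = "S 2 (wY 2 0 d) (wP 2 b) (wP 2 1)" and ?env = "sel d [2, 0] [0, 2 :: nat]"
  have env: "valid_env 2 ?env xy" by (cases d) auto
  from less(2) have "\<exists>m n. spine d m n r \<and> n * b = 0" if "set xy \<subseteq> range Base"
    using that
  proof (cases rule: long_nf_base_cases)
    case (Bound i)
    then have "i = sel d 1 0" using less(3) by (cases d; cases i) auto
    then show ?thesis using Bound spine.intros(1)[of d] by fastforce
  next
    case (Y p q)
    have pq: "long_nf ctype xy (sel d p q) (Base \<alpha>)" "size (sel d p q) < size r"
      using Y by (cases d; simp)+
    have "?S ?env (sel d p q) = 0"
      using less(3) Y env sem_Y[OF bounded_weights long_nf_has_type(1)[OF Y(2)] long_nf_has_type(1)[OF Y(3)] env]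
      by (cases d) (auto simp: wY_def simp del: sem.simps)
    then obtain m n where "spine d m n (sel d p q)" "n * b = 0" using less(1)[OF pq(2,1)] by blast
    then show ?thesis using Y(1) spine.intros(2) by blast
  next
    case (P p)
    have "wP 2 b (?S ?env p) = 0"
      using less(3) P env sem_P[OF bounded_weights long_nf_has_type(1)[OF P(3)] env]
      by (simp del: sem.simps)
    then have "b = 0" "?S ?env p = 0" by (auto simp: wP_def)
    then obtain m n where "spine d m n p" using less(1)[OF _ P(3)] P(1) by auto
    then show ?thesis using P(1) spine.intros(3) \<open>b = 0\<close> by fastforce
  next
    case (f p)
    have "wP 2 1 (?S ?env p) = 0"
      using less(3) f env sem_f[OF bounded_weights long_nf_has_type(1)[OF f(3)] env]
      by (simp del: sem.simps)
    then show ?thesis by (simp add: wP_def)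
  next
    case junky
    then show ?thesis
      using junky_sem[OF bounded_weights _ long_nf_has_type(1)[OF less(2)] env] less(3) by simp
  qed
  then show ?case by auto
qed

text \<open>An interpretation of Y that depends only on side \<open>d\<close> is blind to everything
  off the spine, so the other symbols may be interpreted arbitrarily as long as the spine has no
  P.\<close>

lemma spine_sem:
  assumes "model ctype N J I"
    and Y: "\<And>u v. u \<le> N \<Longrightarrow> v \<le> N \<Longrightarrow> apply_code (apply_code (I (pair_var \<alpha>)) u) v = min N (a + sel d u v)"
    and env: "valid_env N env xy"
    and "spine d m n r" "n = 0" "has_type ctype xy r (Base \<alpha>)"
  shows "sem N J I env r = min N (m * a + env ! sel d 1 0)"
  using assms(4-)
proof (induction rule: spine.induct)
  case 1
  have "env ! sel d 1 0 \<le> N"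
    using list_all2_nthD2[OF env[unfolded valid_env_def], of "sel d 1 0"] by (cases d) auto
  then show ?case by simp
next
  case (2 m n p q)
  interpret model ctype N J I by fact
  have "sem N J I env p \<le> N" "sem N J I env q \<le> N"
    using 2(4) sem_in_dom[OF _ env, of _ "Base \<alpha>"] by auto
  then have "sem N J I env (Y \<alpha> p q) = min N (a + sem N J I env (sel d p q))"
    by (cases d) (simp_all add: Y)
  also have "sem N J I env (sel d p q) = min N (m * a + env ! sel d 1 0)"
  proof (rule 2(2)[OF 2(3)])
    show "has_type ctype xy (sel d p q) (Base \<alpha>)" using 2(4) by (cases d) auto
  qed
  finally show ?case by simp
qed simp

subsection \<open>Instances built from a pair of substitutions\<close>

text \<open>Y extended pointwise to any type by eta-expanding both terms; such terms are substituted
  for the free variables of a generalization.\<close>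

primrec combine :: "'b ty \<Rightarrow> ('b, 'c) trm \<Rightarrow> ('b, 'c) trm \<Rightarrow> ('b, 'c) trm" where
  "combine (Base \<beta>) s t = Y \<beta> s t"
| "combine (A \<rightarrow>\<^sub>t B) s t = Lam A (combine B (App (lift s 0) (Bound 0)) (App (lift t 0) (Bound 0)))"

lemma has_type_eta_body:
  "has_type ctype \<Gamma> t (A \<rightarrow>\<^sub>t B) \<Longrightarrow> has_type ctype (A # \<Gamma>) (App (lift t 0) (Bound 0)) B"
  using has_type_lift[of ctype \<Gamma> t "A \<rightarrow>\<^sub>t B" "[]" \<Gamma> A] has_type.intros(1)[of 0 "A # \<Gamma>" ctype]
  by (auto intro: has_type.intros(5))

lemma has_type_combine:
  "has_type ctype \<Gamma> s T \<Longrightarrow> has_type ctype \<Gamma> t T \<Longrightarrow> has_type ctype \<Gamma> (combine T s t) T"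
proof (induction T arbitrary: \<Gamma> s t rule: ty.induct)
  case (Fun A B)
  show ?case
    unfolding combine.simps by (intro has_type.intros(4) Fun(2) has_type_eta_body Fun(3,4))
qed simp

text \<open>With weight 0, Y is the projection to side \<open>d\<close>, and extensionality carries
  this from base types to all types.\<close>

lemma sem_combine:
  assumes ops: "bounded_ops N (wY N 0 d) pf ff"
    and "has_type ctype \<Gamma> s T" "has_type ctype \<Gamma> t T" "valid_env N env \<Gamma>"
  shows "S N (wY N 0 d) pf ff env (combine T s t) = S N (wY N 0 d) pf ff env (sel d s t)"
  using assms(2-)
proof (induction T arbitrary: \<Gamma> env s t rule: ty.induct)
  case (Base \<beta>)
  then show ?case
    using sem_Y[OF ops Base] sem_base_le[OF ops Base(1,3)] sem_base_le[OF ops Base(2,3)]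
      wY_def[of N 0 d "S N (wY N 0 d) pf ff env s" "S N (wY N 0 d) pf ff env t"]
    by (cases d) (simp_all del: sem.simps)
next
  case (Fun A B)
  interpret spec: model ctype N "spec_J N ff" "spec_I N (wY N 0 d) pf"
    using ops by (rule spec_model)
  let ?S = "S N (wY N 0 d) pf ff"
  have "?S (v # env) (combine B (App (lift s 0) (Bound 0)) (App (lift t 0) (Bound 0)))
      = apply_code (?S env (sel d s t)) v" if "v \<in> dom_ty N A" for v
  proof -
    have "?S (v # env) (lift w 0) = ?S env w" for w
      using sem_lift[of N _ _ "[]" v env w] by simp
    then show ?thesis
      using Fun(2)[of "A # \<Gamma>" "App (lift s 0) (Bound 0)" "App (lift t 0) (Bound 0)" "v # env"]
        Fun(3-5) that by (cases d) (auto simp: has_type_eta_body)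
  qed
  then have "?S env (combine (A \<rightarrow>\<^sub>t B) s t) = graph_code (dom_ty N A) (apply_code (?S env (sel d s t)))"
    by (simp cong: graph_code_cong)
  also have "\<dots> = ?S env (sel d s t)"
    using Fun(3-5) spec.sem_in_dom by (intro graph_code_apply) (cases d; simp)
  finally show ?case .
qed

section \<open>Replacing constants by variables\<close>

primrec base_const :: "'b ty \<Rightarrow> ('b, 'c) trm" where
  "base_const (Base \<beta>) = Free (base_var \<beta>)"
| "base_const (A \<rightarrow>\<^sub>t B) = Lam A (base_const B)"

lemma has_type_base_const: "has_type ctype \<Gamma> (base_const T) T"
  by (induction T arbitrary: \<Gamma>) (auto intro: has_type.intros(4) has_type_Free)

lemma sem_base_const: "S N yf pf ff env (base_const T) = junk N T"
  by (induction T arbitrary: env) (auto simp: spec_I_def)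

text \<open>Values stay the same if P is interpreted like f and free variables are interpreted by
  junk: everything but f is replaced by a term that evaluates to junk.\<close>

primrec generic :: "('b, 'c) trm \<Rightarrow> ('b, 'c) trm" where
  "generic (Bound i) = Bound i"
| "generic (Free X) = base_const (snd X)"
| "generic (Const c) = (if c = f then Free unary_var else base_const (ctype c))"
| "generic (Lam A t) = Lam A (generic t)"
| "generic (App t u) = App (generic t) (generic u)"

lemma has_type_generic: "has_type ctype \<Gamma> t T \<Longrightarrow> has_type ctype \<Gamma> (generic t) T"
  by (induction rule: has_type.induct) (auto simp: f intro: has_type.intros has_type_base_const has_type_Free)

lemma sem_generic:
  "S N yf h h env (generic t) = sem N (spec_J N h) (\<lambda>X. junk N (snd X)) env t"
  by (induction t arbitrary: env) (auto simp: sem_base_const spec_J_def, simp add: spec_I_def image_iff)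

definition aux_vars :: "'b fvar set" where
  "aux_vars = insert unary_var (range pair_var \<union> range base_var)"

lemma syms_combine: "syms (combine T s t) \<subseteq> syms s \<union> syms t \<union> Inl ` aux_vars"
proof (induction T arbitrary: s t)
  case (Fun A B)
  then show ?case using Fun(2)[of "App (lift s 0) (Bound 0)" "App (lift t 0) (Bound 0)"] by simp
qed (auto simp: aux_vars_def)

lemma syms_base_const: "syms (base_const T) \<subseteq> Inl ` aux_vars"
  by (induction T) (auto simp: aux_vars_def)

lemma syms_generic: "syms (generic t) \<subseteq> Inl ` aux_vars"
proof (induction t)
  case (Const c)
  then show ?case using syms_base_const by (auto simp: aux_vars_def)
qed (auto intro: syms_base_const[THEN subsetD])

lemma syms_subst:
  "syms (subst \<sigma> t) \<subseteq> (syms t \<inter> range Inr) \<union> (\<Union>X \<in> fvars t. syms (subst \<sigma> (Free X)))"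
  by (induction t) auto

lemma long_nf_xy_Bound: "long_nf ctype xy (Bound (sel d (Suc 0) 0)) (Base \<alpha>)"
  by (rule long_nf_Bound) (auto simp: sel_def)

text \<open>Both bodies agree after f, which adds 1. The bound 2 leaves room to recognize the
  argument 0 from this; under the bound 1 all values of f would coincide.\<close>

lemma sem_at_projection:
  assumes \<sigma>: "is_substitution ctype \<sigma>" and r: "has_type ctype xy r (Base \<alpha>)"
    and conv: "cconv ctype [] (subst \<sigma> (G r)) (G (Bound (sel d 1 0)))"
  shows "sem 2 (spec_J 2 (wP 2 1)) (\<lambda>X. junk 2 (snd X)) (sel d [2, 0] [0, 2]) (subst \<sigma> r) = 0"
proof -
  let ?sem = "sem 2 (spec_J 2 (wP 2 1)) (\<lambda>X. junk 2 (snd X))"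
  interpret junk: model ctype 2 "spec_J 2 (wP 2 1)" "\<lambda>X. junk 2 (snd X)"
    by (rule junk_model[OF bounded_weights])
  define x y :: nat where "x = sel d 0 2" and "y = sel d 2 0"
  have xy: "x \<le> 2" "y \<le> 2" "[y, x] = sel d [2, 0] [0, 2]"
    by (cases d; simp add: x_def y_def)+
  have env: "valid_env 2 [y, x] xy" using xy(1,2) by simp
  have le: "?sem [y, x] t \<le> 2" if "has_type ctype xy t (Base \<alpha>)" for t
    using junk.sem_in_dom[OF that env] by simp
  have "?sem [] (G (subst \<sigma> r)) = ?sem [] (G (Bound (sel d 1 0)))"
    using junk.sem_cconv[OF conv, of "[]"] by simp
  then have eq: "?sem [] (G (subst \<sigma> r)) = ?sem [] (G (Bound (sel d (Suc 0) 0)))"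
    unfolding One_nat_def .
  have "wP 2 1 (?sem [y, x] (subst \<sigma> r)) = wP 2 1 (?sem [y, x] (Bound (sel d (Suc 0) 0) :: ('b, 'c) trm))"
    by (rule sem_G_eqD[OF eq xy(1,2) le[OF has_type_subst[OF \<sigma> r]] le[OF long_nf_has_type(1)[OF long_nf_xy_Bound]]])
  also have "?sem [y, x] (Bound (sel d (Suc 0) 0) :: ('b, 'c) trm) = 0"
    by (cases d) (simp_all add: x_def y_def)
  finally have "?sem [y, x] (subst \<sigma> r) = 0"
    using wP_def[of 2 1 "?sem [y, x] (subst \<sigma> r)"] wP_def[of 2 1 0] by linarith
  then show ?thesis unfolding xy(3) .
qed

text \<open>The two substitutions are merged by \<open>combine\<close>. Where Y projects to side
  \<open>d\<close>, the merged instance has the value of the instance under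
  \<open>\<sigma> d\<close>, which is 0, and this forces the spine. The last two conclusions serve
  the superpattern case.\<close>

lemma exists_spine_instance:
  assumes r: "has_type ctype xy r (Base \<alpha>)"
    and \<sigma>: "\<And>d. is_substitution ctype (\<sigma> d)"
    and conv: "\<And>d. cconv ctype [] (subst (\<sigma> d) (G r)) (G (Bound (sel d 1 0)))"
  obtains \<rho> q k where "is_substitution ctype \<rho>" "cconv ctype xy (subst \<rho> r) q"
    "long_nf ctype xy q (Base \<alpha>)" "\<And>d. spine d (k d) 0 q"
    "syms q \<subseteq> (syms r \<inter> range Inr) \<union> Inl ` aux_vars"
    "S 2 (wY 2 0 True) (wP 2 1) (wP 2 1) [2, 0] (subst \<rho> r) = 0"
proof -
  define M where "M X = combine (snd X) (generic (subst (\<sigma> True) (Free X))) (generic (subst (\<sigma> False) (Free X)))" for X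
  have gen: "has_type ctype [] (generic (subst (\<sigma> d) (Free X))) (snd X)" for d X
    using is_substitution_has_type[OF \<sigma>] by (rule has_type_generic)
  have "has_type ctype [] (M X) (snd X)" for X
    unfolding M_def by (intro has_type_combine gen)
  then obtain \<rho> where \<rho>: "is_substitution ctype \<rho>"
    and \<rho>M: "\<And>X. X \<in> fvars r \<Longrightarrow> cconv ctype [] (M X) (subst \<rho> (Free X)) \<and> syms (subst \<rho> (Free X)) \<subseteq> syms (M X)"
    using exists_substitution[of "fvars r" ctype M] by auto
  obtain q where q: "long_nf ctype xy q (Base \<alpha>)" "cconv ctype xy (subst \<rho> r) q" "syms q \<subseteq> syms (subst \<rho> r)"
    using normalization[OF has_type_subst[OF \<rho> r]] by blast
  have zero: "S 2 (wY 2 0 d) (wP 2 1) (wP 2 1) (sel d [2, 0] [0, 2]) (subst \<rho> r) = 0" for d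
  proof -
    let ?S = "S 2 (wY 2 0 d) (wP 2 1) (wP 2 1)"
    let ?sem = "sem 2 (spec_J 2 (wP 2 1)) (\<lambda>X. junk 2 (snd X))"
    interpret spec: model ctype 2 "spec_J 2 (wP 2 1)" "spec_I 2 (wY 2 0 d) (wP 2 1)"
      by (rule spec_model[OF bounded_weights])
    interpret junk: model ctype 2 "spec_J 2 (wP 2 1)" "\<lambda>X. junk 2 (snd X)"
      by (rule junk_model[OF bounded_weights])
    have eq: "?S [] (subst \<rho> (Free X)) = ?sem [] (subst (\<sigma> d) (Free X))" if "X \<in> fvars r" for X
    proof -
      have "cconv ctype [] (M X) (subst \<rho> (Free X))" using \<rho>M[OF that] ..
      then have "?S [] (subst \<rho> (Free X)) = ?S [] (M X)"
        using spec.sem_cconv valid_env_simps(1) by metis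
      also have "\<dots> = ?S [] (generic (subst (\<sigma> d) (Free X)))"
        unfolding M_def using sem_combine[OF bounded_weights gen gen valid_env_simps(1)] by (cases d) (simp_all del: subst.simps)
      also have "\<dots> = ?sem [] (subst (\<sigma> d) (Free X))" by (rule sem_generic)
      finally show ?thesis .
    qed
    let ?env = "sel d [2, 0] [0, 2]" and ?I = "\<lambda>X. ?sem [] (subst (\<sigma> d) (Free X))"
    have "?S ?env (subst \<rho> r) = sem 2 (spec_J 2 (wP 2 1)) ?I ?env r"
      by (rule spec.sem_subst[OF \<rho> eq])
    also have "\<dots> = ?sem ?env (subst (\<sigma> d) r)"
      by (rule junk.sem_subst[OF \<sigma> refl, symmetric])
    also have "\<dots> = 0" by (rule sem_at_projection[OF \<sigma> r conv])
    finally show ?thesis .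
  qed
  \<comment> \<open>P has weight 1 here, so the spine contains no P.\<close>
  have "\<exists>m. spine d m 0 q" for d
  proof -
    interpret spec: model ctype 2 "spec_J 2 (wP 2 1)" "spec_I 2 (wY 2 0 d) (wP 2 1)"
      by (rule spec_model[OF bounded_weights])
    have "valid_env 2 (sel d [2, 0] [0, 2]) xy" by (cases d) auto
    then have "S 2 (wY 2 0 d) (wP 2 1) (wP 2 1) (sel d [2, 0] [0, 2]) q = 0"
      using zero spec.sem_cconv[OF q(2)] by metis
    from exists_spine[OF q(1) this] show ?thesis by auto
  qed
  then obtain k where k: "\<And>d. spine d (k d) 0 q" by metis
  \<comment> \<open>The constants of both substitutions have been replaced by variables, so those of
    \<open>q\<close> can only come from \<open>r\<close>.\<close>
  have "syms (M X) \<subseteq> Inl ` aux_vars" for X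
    using syms_combine syms_generic unfolding M_def by blast
  then have "syms q \<subseteq> (syms r \<inter> range Inr) \<union> Inl ` aux_vars"
    using q(3) syms_subst[of \<rho> r] \<rho>M by blast
  then show ?thesis using that[OF \<rho> q(2,1) k] zero[of True] by simp
qed

text \<open>In this two-valued model f yields 0, while Y, P, junk and both bound variables yield 1.
  An instance of \<open>G p\<close> has a body of value 0, so its long normal form must have f on
  top.\<close>

lemma G_shape:
  assumes \<sigma>: "is_substitution ctype \<sigma>" and conv: "cconv ctype [] (subst \<sigma> (G p)) g"
    and p: "has_type ctype xy p (Base \<alpha>)" and g: "long_nf ctype [] g T"
  obtains r where "g = G r" "long_nf ctype xy r (Base \<alpha>)"
proof -
  let ?S = "S 1 (\<lambda>_ _. 1) (\<lambda>_. 1) (\<lambda>_. 0)"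
  have ops: "bounded_ops 1 (\<lambda>_ _. 1) (\<lambda>_. 1) (\<lambda>_. 0)" by (simp add: bounded_ops_def)
  interpret model ctype 1 "spec_J 1 (\<lambda>_. 0)" "spec_I 1 (\<lambda>_ _. 1) (\<lambda>_. 1)"
    using ops by (rule spec_model)
  have "T = Base \<alpha> \<rightarrow>\<^sub>t Base \<alpha> \<rightarrow>\<^sub>t Base \<alpha>"
    using cconv_has_type[OF conv] has_type_subst[OF \<sigma> has_type_G[OF p]]
      long_nf_has_type(1)[OF g] has_type_unique by blast
  then obtain r0 where r0: "g = Lam (Base \<alpha>) (Lam (Base \<alpha>) r0)" "long_nf ctype xy r0 (Base \<alpha>)"
    using g by (auto elim!: long_nf_FunE)
  have env: "valid_env 1 [1, 1] xy" by simp
  have "apply_code (apply_code (?S [] (subst \<sigma> (G p))) 1) 1 = apply_code (apply_code (?S [] g) 1) 1"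
    using sem_cconv[OF conv, of "[]"] by simp
  then have "?S [1, 1] (App (Const f) (subst \<sigma> p)) = ?S [1, 1] r0"
    by (simp add: G_def r0(1) del: sem.simps(5))
  then have zero: "?S [1, 1] r0 = 0"
    using sem_f[OF ops has_type_subst[OF \<sigma> p] env] by (simp del: sem.simps)
  from r0(2) have "\<exists>p. r0 = App (Const f) p \<and> long_nf ctype xy p (Base \<alpha>)" if "set xy \<subseteq> range Base"
    using that
  proof (cases rule: long_nf_base_cases)
    case (Bound i)
    then show ?thesis using zero by (cases i) auto
  next
    case (Y p q)
    then show ?thesis
      using zero sem_Y[OF ops long_nf_has_type(1)[OF Y(2)] long_nf_has_type(1)[OF Y(3)] env]
      by (simp del: sem.simps)
  next
    case (P p)
    then show ?thesis
      using zero sem_P[OF ops long_nf_has_type(1)[OF P(3)] env] by (simp del: sem.simps)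
  next
    case junky
    then show ?thesis
      using zero junky_sem[OF ops _ long_nf_has_type(1)[OF r0(2)] env] by simp
  qed auto
  then show ?thesis using that r0(1) by (auto simp: G_def)
qed

subsection \<open>Generalizations from spines\<close>

text \<open>Collapses a spine, including its P, to its end variable; the two sides provide the two
  substitutions of a generalization.\<close>

definition proj :: "bool \<Rightarrow> ('b, 'c) substitution" where
  "proj d = [pair_var \<alpha> \<mapsto> Lam (Base \<alpha>) (Lam (Base \<alpha>) (Bound (sel d 1 0))),
    unary_var \<mapsto> Lam (Base \<alpha>) (Bound 0)]"

lemma is_substitution_proj: "is_substitution ctype (proj d)"
proof (rule is_substitutionI)
  fix X t
  assume "proj d X = Some t"
  then consider "X = pair_var \<alpha>" "t = Lam (Base \<alpha>) (Lam (Base \<alpha>) (Bound (sel d 1 0)))"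
    | "X = unary_var" "t = Lam (Base \<alpha>) (Bound 0)"
    by (auto simp: proj_def split: if_splits)
  then show "long_nf ctype [] t (snd X)"
    by cases (auto intro!: long_nf_neutral.intros(1) long_nf_Bound simp: sel_def)
qed (simp add: proj_def)

lemma cconv_beta2:
  assumes t: "has_type ctype (B # A # \<Gamma>) t C" and "has_type ctype \<Gamma> p A" "has_type ctype \<Gamma> q B"
  shows "cconv ctype \<Gamma> (App (App (Lam A (Lam B t)) p) q) (bsubst (bsubst t (lift p 0) 1) q 0)"
proof -
  have T: "has_type ctype \<Gamma> (App (App (Lam A (Lam B t)) p) q) C"
    by (rule has_type.intros(5)[OF has_type.intros(5)]) (use assms in \<open>auto intro!: has_type.intros(4)\<close>)
  have "beta (App (App (Lam A (Lam B t)) p) q) (App (Lam B (bsubst t (lift p 0) 1)) q)"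
    using beta.intros(2)[OF beta.intros(1)[of A "Lam B t" p], of q] by simp
  moreover have "beta (App (Lam B (bsubst t (lift p 0) 1)) q) (bsubst (bsubst t (lift p 0) 1) q 0)"
    by (rule beta.intros)
  ultimately have "beta\<^sup>*\<^sup>* (App (App (Lam A (Lam B t)) p) q) (bsubst (bsubst t (lift p 0) 1) q 0)"
    by (meson converse_rtranclp_into_rtranclp r_into_rtranclp)
  from betas_cconv[OF this T] show ?thesis ..
qed

lemma spine_cconv:
  "spine d m n r \<Longrightarrow> has_type ctype xy r (Base \<alpha>) \<Longrightarrow> cconv ctype xy (subst (proj d) r) (Bound (sel d 1 0))"
proof (induction rule: spine.induct)
  case (2 m n p q)
  let ?p = "subst (proj d) p" and ?q = "subst (proj d) q"
  have pq: "has_type ctype xy ?p (Base \<alpha>)" "has_type ctype xy ?q (Base \<alpha>)"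
    using 2(3) has_type_subst[OF is_substitution_proj] by auto
  have "cconv ctype xy (App (App (Lam (Base \<alpha>) (Lam (Base \<alpha>) (Bound (sel d 1 0)))) ?p) ?q)
      (bsubst (bsubst (Bound (sel d 1 0)) (lift ?p 0) 1) ?q 0)"
  proof (rule cconv_beta2[OF _ pq])
    show "has_type ctype (Base \<alpha> # Base \<alpha> # xy) (Bound (sel d 1 0)) (Base \<alpha>)"
      by (rule long_nf_has_type(1)[OF long_nf_Bound]) (auto simp: sel_def)
  qed
  then have "cconv ctype xy (subst (proj d) (Y \<alpha> p q)) (sel d ?p ?q)"
    by (cases d) (simp_all add: proj_def)
  also have "cconv ctype xy (sel d ?p ?q) (Bound (sel d 1 0))"
    using 2(2,3) by (cases d) auto
  finally show ?case .
next
  case (3 m n p)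
  let ?p = "subst (proj d) p"
  have p: "has_type ctype xy p (Base \<alpha>)" using 3(3) by simp
  have red: "beta (subst (proj d) (P p)) ?p"
    using beta.intros(1)[of "Base \<alpha>" "Bound 0" ?p] by (simp add: proj_def)
  have "cconv ctype xy (subst (proj d) (P p)) ?p"
    using red has_type_subst[OF is_substitution_proj 3(3)] by (rule beta_cconv)
  also note 3(2)[OF p]
  finally show ?case .
qed simp

lemma spine_generalization:
  assumes L: "G r \<in> L" and r: "has_type ctype xy r (Base \<alpha>)" and sp: "\<And>d. \<exists>m n. spine d m n r"
  shows "G r \<in> generalizations ctype L (G (Bound 1)) (G (Bound 0))"
proof -
  have "cconv ctype [] (subst (proj d) (G r)) (G (Bound (sel d 1 0)))" for d
    using sp[of d] spine_cconv[OF _ r] cconv_G has_type_subst[OF is_substitution_proj r] by fastforce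
  from this[of True] this[of False] show ?thesis
    using L is_substitution_proj unfolding generalizations_def conv_eq_cconv
    by (auto simp del: subst_G)
qed

subsection \<open>Doubling the spine\<close>

text \<open>The way to the first argument passes Y and P twice, the way to the second only once.
  Every argument of Y is headed by P.\<close>

definition double_term :: "('b, 'c) trm" where
  "double_term = Lam (Base \<alpha>) (Lam (Base \<alpha>)
     (Y \<alpha> (P (Y \<alpha> (P (Bound 1)) (P (Bound 0)))) (P (Bound 0))))"

definition double :: "('b, 'c) substitution" where
  "double = [pair_var \<alpha> \<mapsto> double_term]"

lemma long_nf_double_term: "long_nf ctype [] double_term (Base \<alpha> \<rightarrow>\<^sub>t Base \<alpha> \<rightarrow>\<^sub>t Base \<alpha>)"
  unfolding double_term_def by (intro long_nf_neutral.intros(1) long_nf_YP long_nf_Bound) simp_all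

lemma is_substitution_double: "is_substitution ctype double"
  by (rule is_substitutionI) (use long_nf_double_term in \<open>simp_all add: double_def split: if_splits\<close>)

text \<open>The doubled term is evaluated as \<open>q\<close> with Y reinterpreted by the value of
  \<open>double_term\<close>. Each pair of a Y and a P costs \<open>m + l\<close>, with two pairs on
  the left side and one on the right.\<close>

lemma sem_double:
  assumes "model ctype N J I"
    and Y: "\<And>u v. u \<le> N \<Longrightarrow> v \<le> N \<Longrightarrow> apply_code (apply_code (I (pair_var \<alpha>)) u) v = min N (m + sel e u v)"
    and P: "\<And>u. u \<le> N \<Longrightarrow> apply_code (I unary_var) u = min N (l + u)"
    and sp: "spine e k 0 q" and q: "has_type ctype xy q (Base \<alpha>)" and env: "valid_env N env xy"
  shows "sem N J I env (subst double q) = min N (k * ((if e then 2 else 1) * (m + l)) + env ! sel e 1 0)"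
proof -
  interpret model ctype N J I by fact
  interpret double: model ctype N J "\<lambda>X. sem N J I [] (subst double (Free X))"
    by (rule subst_model[OF is_substitution_double])
  have "sem N J I env (subst double q) = sem N J (\<lambda>X. sem N J I [] (subst double (Free X))) env q"
    by (rule sem_subst[OF is_substitution_double]) simp
  also have "\<dots> = min N (k * ((if e then 2 else 1) * (m + l)) + env ! sel e 1 0)"
  proof (rule spine_sem[OF double.model_axioms _ env sp _ q])
    fix u v assume "u \<le> N" "v \<le> N"
    then show "apply_code (apply_code (sem N J I [] (subst double (Free (pair_var \<alpha>)))) u) v =
        min N ((if e then 2 else 1) * (m + l) + sel e u v)"
      by (cases e) (simp_all add: double_def double_term_def Y P)
  qed simp
  finally show ?thesis .
qed

text \<open>Whatever is substituted for P, or in the next lemma for Y, can only add a fixed weight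
  to one argument: the body of its long normal form follows a single path. Paths ending in junk
  count as a saturating weight.\<close>

lemma closed_unary_weight:
  assumes "has_type ctype [] t (Base \<alpha> \<rightarrow>\<^sub>t Base \<alpha>)"
  shows "\<exists>m. \<forall>u \<le> N. apply_code (S N (wY N a d) (wP N b) (wP N c) [] t) u = min N (m + u)"
proof -
  let ?S = "S N (wY N a d) (wP N b) (wP N c)"
  interpret spec: model ctype N "spec_J N (wP N c)" "spec_I N (wY N a d) (wP N b)"
    by (rule spec_model[OF bounded_weights])
  obtain v where v: "long_nf ctype [] v (Base \<alpha> \<rightarrow>\<^sub>t Base \<alpha>)" "cconv ctype [] t v"
    using normalization[OF assms] by blast
  then obtain w where w: "v = Lam (Base \<alpha>) w" "long_nf ctype [Base \<alpha>] w (Base \<alpha>)"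
    by (auto elim: long_nf_FunE)
  obtain m where "\<And>env. valid_env N env [Base \<alpha>] \<Longrightarrow> ?S env w = min N (m + env ! 0)"
    using weight_form[OF w(2), where N = N and a = a and d = d and b = b and c = c] by auto
  then have "apply_code (?S [] v) u = min N (m + u)" if "u \<le> N" for u
    using that by (simp add: w(1))
  then show ?thesis using spec.sem_cconv[OF v(2), of "[]"] by auto
qed

lemma closed_binary_weight:
  assumes "has_type ctype [] t (Base \<alpha> \<rightarrow>\<^sub>t Base \<alpha> \<rightarrow>\<^sub>t Base \<alpha>)"
  shows "\<exists>m e. \<forall>u \<le> N. \<forall>v \<le> N.
    apply_code (apply_code (S N (wY N a d) (wP N b) (wP N c) [] t) u) v = min N (m + sel e u v)"
proof -
  let ?S = "S N (wY N a d) (wP N b) (wP N c)"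
  interpret spec: model ctype N "spec_J N (wP N c)" "spec_I N (wY N a d) (wP N b)"
    by (rule spec_model[OF bounded_weights])
  obtain t' where v: "long_nf ctype [] t' (Base \<alpha> \<rightarrow>\<^sub>t Base \<alpha> \<rightarrow>\<^sub>t Base \<alpha>)" "cconv ctype [] t t'"
    using normalization[OF assms] by blast
  then obtain w where w: "t' = Lam (Base \<alpha>) (Lam (Base \<alpha>) w)" "long_nf ctype xy w (Base \<alpha>)"
    by (auto elim!: long_nf_FunE)
  have "set xy \<subseteq> range Base" by auto
  from weight_form[OF w(2) this, where N = N and a = a and d = d and b = b and c = c]
  obtain m i where "i < length xy" and m: "\<And>env. valid_env N env xy \<Longrightarrow> ?S env w = min N (m + env ! i)"
    by blast
  then have i: "i < 2" by simp
  \<comment> \<open>Index 1 is the outer binder and hence the first argument.\<close>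
  have "[v, u] ! i = sel (i = 1) u v" for u v :: nat
    using i by (cases i) (auto simp: sel_def)
  then have "apply_code (apply_code (?S [] t') u) v = min N (m + sel (i = 1) u v)" if "u \<le> N" "v \<le> N" for u v
    using that m[of "[v, u]"] by (simp add: w(1))
  then show ?thesis using spec.sem_cconv[OF v(2), of "[]"] by auto
qed

text \<open>
  With \<open>Y\<close> read as \<open>u, v \<mapsto> 1 + u\<close>, \<open>x\<close> as 0 and \<open>y\<close> as the absorbing bound \<open>N\<close>, the value of
  \<open>q\<close> is the number \<open>k > 0\<close> of \<open>Y\<close>s on its left spine. In any instance of the doubled term
  the value is either \<open>2 * c * k\<close> for some \<open>c\<close>, or \<open>N\<close>.
\<close>

lemma double_not_more_general:
  assumes q: "has_type ctype xy q (Base \<alpha>)" and sp: "\<And>d. spine d (k d) 0 q"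
    and q': "cconv ctype xy (subst double q) q'" "has_type ctype xy q' (Base \<alpha>)"
    and \<tau>: "is_substitution ctype \<tau>"
  shows "\<not> cconv ctype [] (subst \<tau> (G q')) (G q)"
proof
  assume conv: "cconv ctype [] (subst \<tau> (G q')) (G q)"
  \<comment> \<open>One more than the length of the left spine, so that this length is not truncated
    and differs from the absorbing value.\<close>
  define N where "N = Suc (k True)"
  let ?J = "spec_J N (wP N 0)" and ?I = "spec_I N (wY N 1 True) (wP N 0)"
  let ?I' = "\<lambda>X. sem N ?J ?I [] (subst \<tau> (Free X))"
  interpret spec: model ctype N ?J ?I by (rule spec_model[OF bounded_weights])
  interpret inst: model ctype N ?J ?I' by (rule spec.subst_model[OF \<tau>])
  have env: "valid_env N [N, 0] xy" by simp
  \<comment> \<open>Without a Y on the left spine \<open>q\<close> is x, and then the right spine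
    cannot end in y.\<close>
  have k: "k True \<noteq> 0"
  proof
    assume "k True = 0"
    then have "spine True 0 0 q" using sp[of True] by simp
    then have "q = Bound 1" by cases simp
    then have "spine False (k False) 0 (Bound 1)" using sp[of False] by simp
    then show False by cases simp_all
  qed
  have left: "sem N ?J ?I [N, 0] q = k True"
    using spine_sem[OF spec.model_axioms _ env sp _ q, of 1 True]
    by (simp add: spec_I_def wY_def N_def)
  obtain m e where me: "\<And>u v. u \<le> N \<Longrightarrow> v \<le> N \<Longrightarrow> apply_code (apply_code (?I' (pair_var \<alpha>)) u) v = min N (m + sel e u v)"
    using closed_binary_weight[where t = "subst \<tau> (Free (pair_var \<alpha>))" and N = N and a = 1 and d = True and b = 0 and c = 0]
      is_substitution_has_type[OF \<tau>, of "pair_var \<alpha>"] by (auto simp del: subst.simps)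
  obtain l where l: "\<And>u. u \<le> N \<Longrightarrow> apply_code (?I' unary_var) u = min N (l + u)"
    using closed_unary_weight[where t = "subst \<tau> (Free unary_var)" and N = N and a = 1 and d = True and b = 0 and c = 0]
      is_substitution_has_type[OF \<tau>, of unary_var] by (auto simp del: subst.simps)
  have "sem N ?J ?I' [N, 0] q' = sem N ?J ?I' [N, 0] (subst double q)"
    using inst.sem_cconv[OF q'(1) env] by simp
  also have "\<dots> = min N (k e * ((if e then 2 else 1) * (m + l)) + [N, 0] ! sel e 1 0)"
    using inst.model_axioms me l sp q env by (rule sem_double)
  finally have right: "sem N ?J ?I' [N, 0] q' = min N (k e * ((if e then 2 else 1) * (m + l)) + [N, 0] ! sel e 1 0)" .
  have "sem N ?J ?I [] (subst \<tau> (G q')) = sem N ?J ?I' [] (G q')"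
    by (rule spec.sem_subst[OF \<tau>]) simp
  then have "sem N ?J ?I' [] (G q') = sem N ?J ?I [] (G q)"
    using spec.sem_cconv[OF conv, of "[]"] by simp
  \<comment> \<open>With weight 0, f is the identity on values up to \<open>N\<close>.\<close>
  then have "wP N 0 (sem N ?J ?I' [N, 0] q') = wP N 0 (sem N ?J ?I [N, 0] q)"
    by (rule sem_G_eqD) (simp_all only: left right, simp_all add: N_def)
  then have eq: "min N (k e * ((if e then 2 else 1) * (m + l)) + [N, 0] ! sel e 1 0) = k True"
    unfolding left right by (simp add: wP_def N_def)
  show False
  proof (cases e)
    case True
    with eq have "k True * (2 * (m + l)) = k True * 1" by (simp add: N_def min_def split: if_splits)
    then show False using k by (simp only: mult_cancel1) presburger
  next
    case False
    with eq show False by (simp add: N_def)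
  qed
qed

end

section \<open>Superpatterns\<close>

text \<open>The head variable after stripping abstractions. Unlike \<open>head\<close> it is
  invariant under eta, which links a long normal term to its eta-normal form.\<close>

primrec core :: "('b, 'c) trm \<Rightarrow> 'b fvar option" where
  "core (Bound i) = None"
| "core (Free X) = Some X"
| "core (Const c) = None"
| "core (Lam A t) = core t"
| "core (App t u) = core t"

lemma core_lift [simp]: "core (lift t k) = core t"
  by (induction t arbitrary: k) auto

lemma core_eta: "eta t u \<Longrightarrow> core u = core t"
  by (induction rule: eta.induct) auto

lemma core_etas: "eta\<^sup>*\<^sup>* t u \<Longrightarrow> core u = core t"
  by (induction rule: rtranclp_induct) (auto dest: core_eta)

lemma core_head: "head t = Free X \<Longrightarrow> core t = Some X"
  by (induction t) auto

lemma core_foldl [simp]: "core (foldl App t ss) = core t"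
  by (induction ss arbitrary: t) auto

lemma foldl_App_eq_iff [simp]:
  "foldl App (Free X) ss = Free Z \<longleftrightarrow> ss = [] \<and> X = Z"
  "foldl App (Free X) ss \<noteq> Bound i"
  "foldl App (Free X) ss \<noteq> Const c"
  "foldl App (Free X) ss \<noteq> Lam A t"
  "foldl App (Free X) ss = App t u \<longleftrightarrow> (\<exists>ss'. ss = ss' @ [u] \<and> foldl App (Free X) ss' = t)"
  by (cases ss rule: rev_cases; auto)+

primrec lambda_free :: "('b, 'c) trm \<Rightarrow> bool" where
  "lambda_free (Bound i) \<longleftrightarrow> True"
| "lambda_free (Free X) \<longleftrightarrow> True"
| "lambda_free (Const c) \<longleftrightarrow> True"
| "lambda_free (Lam A t) \<longleftrightarrow> False"
| "lambda_free (App t u) \<longleftrightarrow> lambda_free t \<and> lambda_free u"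

lemma eta_not_lambda_free: "eta t u \<Longrightarrow> \<not> lambda_free t"
  by (induction rule: eta.induct) auto

lemma eta_normal_form_lambda_free: "lambda_free t \<Longrightarrow> eta_normal_form t u \<Longrightarrow> u = t"
  unfolding eta_normal_form_def using eta_not_lambda_free by (metis converse_rtranclpE)

definition pattern_args :: "('b, 'c) trm list \<Rightarrow> bool" where
  "pattern_args ss \<longleftrightarrow> (\<forall>s \<in> set ss. (\<exists>i. s = Bound i) \<or> (\<exists>Y. head s = Free Y)) \<and>
     (\<forall>i < length ss. \<forall>j < length ss. i \<noteq> j \<longrightarrow>
        (\<exists>k. ss ! i = Bound k) \<longrightarrow> (\<exists>k. ss ! j = Bound k) \<longrightarrow> ss ! i \<noteq> ss ! j)"

lemma superpattern_iff:
  "superpattern t \<longleftrightarrow>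
    (\<forall>u \<in> subterms t. \<forall>X ss. eta_normal_form u (foldl App (Free X) ss) \<longrightarrow> pattern_args ss)"
  unfolding superpattern_def pattern_args_def ..

lemma pattern_args_simps [simp]:
  "pattern_args []"
  "pattern_args [s] \<longleftrightarrow> (\<exists>i. s = Bound i) \<or> (\<exists>X. head s = Free X)"
  "pattern_args [p, q] \<longleftrightarrow> pattern_args [p] \<and> pattern_args [q] \<and> (\<forall>i. p = Bound i \<longrightarrow> q \<noteq> p)"
  unfolding pattern_args_def by (auto simp: less_Suc_eq)

lemma lambda_free_subterms: "lambda_free t \<Longrightarrow> u \<in> subterms t \<Longrightarrow> lambda_free u"
  by (induction t) auto

text \<open>Every eta-redex is an abstraction, so each subterm is its own eta-normal form.\<close>

lemma superpattern_lambda_free: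
  assumes "lambda_free t"
  shows "superpattern t \<longleftrightarrow> (\<forall>X ss. foldl App (Free X) ss \<in> subterms t \<longrightarrow> pattern_args ss)"
proof -
  have "eta_normal_form u v \<longleftrightarrow> v = u" if "u \<in> subterms t" for u v
    using lambda_free_subterms[OF assms that] eta_normal_form_lambda_free eta_not_lambda_free
    by (auto simp: eta_normal_form_def)
  then show ?thesis unfolding superpattern_iff by auto
qed

section \<open>Existence of eta-normal forms\<close>

lemma size_lift [simp]: "size (lift t k) = size t"
  by (induction t arbitrary: k) auto

lemma size_eta: "eta t u \<Longrightarrow> size u < size t"
  by (induction rule: eta.induct) auto

lemma exists_eta_normal_form: "\<exists>u. eta_normal_form t u"
proof (induction "size t" arbitrary: t rule: less_induct)
  case less
  show ?case
  proof (cases "\<exists>w. eta t w")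
    case True
    then obtain w where w: "eta t w" ..
    then obtain u where "eta_normal_form w u" using less size_eta by blast
    then show ?thesis using w unfolding eta_normal_form_def by (meson converse_rtranclp_into_rtranclp)
  qed (auto simp: eta_normal_form_def)
qed

lemma etas_App:
  assumes "eta\<^sup>*\<^sup>* t t'" "eta\<^sup>*\<^sup>* u u'"
  shows "eta\<^sup>*\<^sup>* (App t u) (App t' u')"
proof -
  have "eta\<^sup>*\<^sup>* (App t u) (App t' u)"
    using assms(1)
    by (induction rule: rtranclp_induct) (auto intro: eta.intros rtranclp.rtrancl_into_rtrancl)
  also have "eta\<^sup>*\<^sup>* (App t' u) (App t' u')" using assms(2) by (rule etas_App_right)
  finally show ?thesis .
qed

inductive_cases eta_AppE: "eta (App t u) w"
inductive_cases eta_FreeE: "eta (Free X) w"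

text \<open>An applied free variable is no eta-redex itself, so its arguments normalize
  independently.\<close>

lemma eta_normal_form_foldl:
  assumes "\<And>s. s \<in> set ss \<Longrightarrow> eta_normal_form s (nf s)"
  shows "eta_normal_form (foldl App (Free X) ss) (foldl App (Free X) (map nf ss))"
  using assms
proof (induction ss rule: rev_induct)
  case Nil
  then show ?case by (auto simp: eta_normal_form_def elim: eta_FreeE)
next
  case (snoc s ss)
  then have "eta_normal_form (foldl App (Free X) ss) (foldl App (Free X) (map nf ss))"
    "eta_normal_form s (nf s)" by auto
  then show ?case unfolding eta_normal_form_def by (auto intro: etas_App elim: eta_AppE)
qed

lemma subterms_refl [simp]: "t \<in> subterms t"
  by (cases t) auto

lemma subterms_trans: "u \<in> subterms t \<Longrightarrow> v \<in> subterms u \<Longrightarrow> v \<in> subterms t"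
  by (induction t) auto

lemma foldl_App_subterms: "s \<in> set ss \<Longrightarrow> s \<in> subterms (foldl App t ss) \<and> size s < size (foldl App t ss)"
  by (induction ss rule: rev_induct) auto

lemma syms_foldl: "syms (foldl App t ss) = syms t \<union> (\<Union>s \<in> set ss. syms s)"
  by (induction ss rule: rev_induct) auto

lemma neutral_core:
  assumes "neutral ctype \<Gamma> u T" "core u = Some X"
  shows "\<exists>ss. u = foldl App (Free X) ss \<and> (\<forall>s \<in> set ss. \<exists>A. long_nf ctype \<Gamma> s A)"
  using assms
proof (induction u arbitrary: T)
  case (Free Z)
  then show ?case by (intro exI[of _ "[]"]) simp
next
  case (Lam A t)
  then show ?case by (auto elim: neutral.cases)
next
  case (App t u)
  from App(3) obtain A where A: "neutral ctype \<Gamma> t (A \<rightarrow>\<^sub>t T)" "long_nf ctype \<Gamma> u A"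
    by (auto elim: neutral.cases)
  then obtain ss where "t = foldl App (Free X) ss" "\<forall>s \<in> set ss. \<exists>A. long_nf ctype \<Gamma> s A"
    using App(1,4) by auto
  then show ?case using A(2) by (intro exI[of _ "ss @ [u]"]) auto
qed simp_all

text \<open>Arguments of neutral terms may be abstractions; stripping them reaches a neutral subterm
  to which an induction over neutral terms applies again.\<close>

lemma long_nf_body:
  "long_nf ctype \<Gamma> s A \<Longrightarrow> \<exists>\<Delta> b u. neutral ctype \<Delta> u (Base b) \<and> u \<in> subterms s \<and>
    syms u = syms s \<and> core u = core s \<and> size u \<le> size s"
  and "neutral ctype \<Gamma> s A \<Longrightarrow> True"
proof (induction rule: long_nf_neutral.inducts)
  case (1 A \<Gamma> t B)
  then show ?case by fastforce
next
  case (2 \<Gamma> t b)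
  then show ?case using subterms_refl by blast
qed auto

text \<open>
  The arguments of a free variable \<open>\<eta>\<close>-reduce to bound variables or to terms headed again by a free
  variable, so no constant can reappear.
\<close>

lemma superpattern_no_consts:
  fixes g u :: "('b, 'c) trm"
  assumes "superpattern g" "u \<in> subterms g" "neutral ctype \<Gamma> u T" "core u = Some X"
  shows "syms u \<subseteq> range Inl"
  using assms(2-)
proof (induction "size u" arbitrary: u \<Gamma> T X rule: less_induct)
  case less
  obtain ss where ss: "u = foldl App (Free X) ss" "\<forall>s \<in> set ss. \<exists>A. long_nf ctype \<Gamma> s A"
    using neutral_core[OF less(3,4)] by blast
  obtain nf :: "('b, 'c) trm \<Rightarrow> ('b, 'c) trm" where nf: "\<And>s. eta_normal_form s (nf s)"
    using exists_eta_normal_form by metis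
  have "eta_normal_form u (foldl App (Free X) (map nf ss))"
    unfolding ss(1) by (rule eta_normal_form_foldl) (rule nf)
  then have args: "\<forall>s \<in> set (map nf ss). (\<exists>i. s = Bound i) \<or> (\<exists>Z. head s = Free Z)"
    using assms(1) less(2) unfolding superpattern_iff pattern_args_def by blast
  have "syms s \<subseteq> range Inl" if s: "s \<in> set ss" for s
  proof -
    have red: "eta\<^sup>*\<^sup>* s (nf s)" using nf by (simp add: eta_normal_form_def)
    from args s have "(\<exists>i. nf s = Bound i) \<or> (\<exists>Z. head (nf s) = Free Z)" by simp
    then show ?thesis
    proof (elim disjE exE)
      \<comment> \<open>Eta-reduction preserves \<open>syms\<close>, so \<open>s\<close> contains no
        symbol at all.\<close>
      fix i assume "nf s = Bound i"
      then show ?thesis using syms_etas[OF red] by simp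
    next
      fix Z assume "head (nf s) = Free Z"
      then have core: "core s = Some Z" using core_head core_etas[OF red] by metis
      obtain A where "long_nf ctype \<Gamma> s A" using ss(2) s by blast
      from long_nf_body(1)[OF this] obtain \<Delta> b w where w: "neutral ctype \<Delta> w (Base b)" "w \<in> subterms s"
        "syms w = syms s" "core w = core s" "size w \<le> size s" by blast
      have "s \<in> subterms u" "size s < size u" using foldl_App_subterms[OF s] ss(1) by auto
      then have "syms w \<subseteq> range Inl"
        using less(1)[of w \<Delta> "Base b" Z] w core less(2) subterms_trans by (metis le_less_trans)
      then show ?thesis using w(3) by simp
    qed
  qed
  then show ?case unfolding ss(1) syms_foldl by auto
qed

context unary_constant
begin

section \<open>First-order terms over Y and P\<close>

inductive first_order :: "('b, 'c) trm \<Rightarrow> bool" where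
  "i < 2 \<Longrightarrow> first_order (Bound i)"
| "first_order (Free (base_var \<alpha>))"
| "first_order t \<Longrightarrow> first_order (P t)"
| "first_order p \<Longrightarrow> first_order q \<Longrightarrow> first_order (Y \<alpha> p q)"

text \<open>The added condition on Y is the distinctness of bound arguments; all other arguments
  have a free variable as head.\<close>

inductive first_order_sp :: "('b, 'c) trm \<Rightarrow> bool" where
  "i < 2 \<Longrightarrow> first_order_sp (Bound i)"
| "first_order_sp (Free (base_var \<alpha>))"
| "first_order_sp t \<Longrightarrow> first_order_sp (P t)"
| "first_order_sp p \<Longrightarrow> first_order_sp q \<Longrightarrow> (\<And>i. p = Bound i \<Longrightarrow> q \<noteq> p) \<Longrightarrow> first_order_sp (Y \<alpha> p q)"

lemma first_order_sp_imp: "first_order_sp t \<Longrightarrow> first_order t"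
  by (induction rule: first_order_sp.induct) (auto intro: first_order.intros)

lemma long_nf_first_order: "first_order t \<Longrightarrow> long_nf ctype xy t (Base \<alpha>)"
proof (induction rule: first_order.induct)
  case (1 i)
  then show ?case by (intro long_nf_Bound) (auto simp: less_2_cases_iff)
next
  case 2
  then show ?case by (intro long_nf_neutral.intros(2) neutral_Free) simp
qed (auto intro: long_nf_YP)

lemma junky_aux:
  assumes "junky t" "syms t \<subseteq> Inl ` aux_vars" "has_type ctype \<Gamma> t T"
  shows "\<exists>\<beta>. t = Free (base_var \<beta>) \<and> T = Base \<beta>"
  using assms
proof (induction arbitrary: T rule: junky.induct)
  case (2 X)
  then show ?case by (auto simp: aux_vars_def elim!: has_type_FreeE)
next
  case (3 t u)
  from 3(4) obtain A where "has_type ctype \<Gamma> t (A \<rightarrow>\<^sub>t T)" by (rule has_type_AppE)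
  then show ?case using 3(2)[of "A \<rightarrow>\<^sub>t T"] 3(3) by simp
qed auto

text \<open>The constant f is excluded by \<open>syms\<close>. Among the auxiliary variables other
  than Y and P only \<open>base_var\<close> remains, which takes no arguments.\<close>

lemma first_order_if_aux:
  assumes "long_nf ctype xy t (Base \<alpha>)" "syms t \<subseteq> Inl ` aux_vars"
  shows "first_order t"
  using assms
proof (induction "size t" arbitrary: t rule: less_induct)
  case less
  have "set xy \<subseteq> range Base" by simp
  with less(2) show ?case
  proof (cases rule: long_nf_base_cases)
    case (Bound i)
    then show ?thesis by (auto intro: first_order.intros)
  next
    case (Y p q)
    then show ?thesis using less(1)[of p] less(1)[of q] less(3) by (auto intro: first_order.intros)
  next
    case (P p)
    then show ?thesis using less(1)[of p] less(3) by (auto intro: first_order.intros)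
  next
    case (f p)
    then show ?thesis using less(3) by auto
  next
    case junky
    then show ?thesis
      using junky_aux[OF junky less(3) long_nf_has_type(1)[OF less(2)]] by (auto intro: first_order.intros)
  qed
qed

lemma cconv_YP:
  assumes "cconv ctype xy p p'" "has_type ctype xy p (Base \<alpha>)"
  shows "cconv ctype xy (P p) (P p')"
  by (rule cconv_App[OF cconv_refl assms(1) has_type_Free assms(2)]) simp

lemma subst_double [simp]:
  "subst double (Free (base_var \<beta>)) = Free (base_var \<beta>)"
  "subst double (P t) = P (subst double t)"
  "subst double (Y \<alpha> p q) = App (App double_term (subst double p)) (subst double q)"
  by (simp_all add: double_def)

text \<open>After doubling, both arguments of every Y are headed by P, so equal bound arguments
  disappear even if \<open>t\<close> applies Y to x twice.\<close>

lemma double_first_order: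
  "first_order t \<Longrightarrow> \<exists>t'. cconv ctype xy (subst double t) t' \<and> first_order_sp t'"
proof (induction rule: first_order.induct)
  case (1 i)
  then show ?case by (intro exI[of _ "Bound i"]) (auto intro: first_order_sp.intros)
next
  case 2
  then show ?case
    by (intro exI[of _ "Free (base_var \<alpha>)"]) (auto intro: first_order_sp.intros simp del: subst.simps)
next
  case (3 t)
  then obtain t' where t': "cconv ctype xy (subst double t) t'" "first_order_sp t'" by blast
  have t: "has_type ctype xy (subst double t) (Base \<alpha>)"
    using 3(1) has_type_subst[OF is_substitution_double] long_nf_has_type(1) long_nf_first_order by blast
  show ?case
    using cconv_YP[OF t'(1) t] t'(2)
    by (intro exI[of _ "P t'"]) (auto intro: first_order_sp.intros simp del: subst.simps)
next
  case (4 p q)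
  then obtain p' q' where p': "cconv ctype xy (subst double p) p'" "first_order_sp p'"
    and q': "cconv ctype xy (subst double q) q'" "first_order_sp q'" by blast
  note [intro] = has_type_subst[OF is_substitution_double] long_nf_has_type(1) long_nf_first_order
  have p: "has_type ctype xy (subst double p) (Base \<alpha>)" and q: "has_type ctype xy (subst double q) (Base \<alpha>)"
    using 4 by blast+
  have p't: "has_type ctype xy p' (Base \<alpha>)" and q't: "has_type ctype xy q' (Base \<alpha>)"
    using p' q' first_order_sp_imp by blast+
  have D: "has_type ctype xy double_term (Base \<alpha> \<rightarrow>\<^sub>t Base \<alpha> \<rightarrow>\<^sub>t Base \<alpha>)"
    using long_nf_has_type(1)[OF long_nf_double_term] by (rule has_type_closed)
  have "subst double (Y \<alpha> p q) = App (App double_term (subst double p)) (subst double q)"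
    by (rule subst_double)
  also have "cconv ctype xy \<dots> (App (App double_term p') q')"
    by (intro cconv_App[OF cconv_App[OF cconv_refl p'(1) D p] q'(1) has_type.intros(5)[OF D p] q])
  also have "cconv ctype xy (App (App double_term p') q')
      (Y \<alpha> (P (Y \<alpha> (P p') (P q'))) (P q'))"
  proof -
    have "has_type ctype (Base \<alpha> # Base \<alpha> # xy) (Bound i) (Base \<alpha>)" if "i < 2" for i
      using that by (intro long_nf_has_type(1)[OF long_nf_Bound]) (auto simp: less_2_cases_iff)
    then have "has_type ctype (Base \<alpha> # Base \<alpha> # xy) (Y \<alpha> (P (Y \<alpha> (P (Bound 1)) (P (Bound 0)))) (P (Bound 0))) (Base \<alpha>)"
      by simp
    from cconv_beta2[OF this p't q't] show ?thesis by (simp add: double_term_def)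
  qed
  finally have "cconv ctype xy (subst double (Y \<alpha> p q)) (Y \<alpha> (P (Y \<alpha> (P p') (P q'))) (P q'))" .
  moreover have "first_order_sp (Y \<alpha> (P (Y \<alpha> (P p') (P q'))) (P q'))"
    using p'(2) q'(2) by (intro first_order_sp.intros) auto
  ultimately show ?case by blast
qed

lemma first_order_head: "first_order t \<Longrightarrow> (\<exists>i. t = Bound i) \<or> (\<exists>X. head t = Free X)"
  by (induction rule: first_order.induct) auto

lemma superpattern_first_order_sp:
  assumes "first_order_sp t"
  shows "superpattern t"
proof -
  have "lambda_free t \<and> (\<forall>X ss. foldl App (Free X) ss \<in> subterms t \<longrightarrow> pattern_args ss)"
    using assms
  proof (induction rule: first_order_sp.induct)
    case (3 t)
    then show ?case using first_order_head[OF first_order_sp_imp[OF 3(1)]] by auto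
  next
    case (4 p q)
    then show ?case
      using first_order_head[OF first_order_sp_imp[OF 4(1)]] first_order_head[OF first_order_sp_imp[OF 4(2)]]
      by auto
  qed auto
  then show ?thesis by (simp add: superpattern_lambda_free)
qed

lemma superpattern_G:
  assumes "first_order_sp t"
  shows "superpattern (G t)"
proof -
  have "u \<in> subterms t" if "u \<in> subterms (G t)" "eta_normal_form u (foldl App (Free X) ss)" for u X ss
  proof -
    \<comment> \<open>\<open>core\<close> is eta-invariant and is \<open>None\<close> on the parts
      of \<open>G t\<close> outside \<open>t\<close>.\<close>
    have "core u = Some X"
      using core_etas[of u "foldl App (Free X) ss"] that(2) unfolding eta_normal_form_def by simp
    then show ?thesis using that(1) by (auto simp: G_def)
  qed
  then show ?thesis
    using superpattern_first_order_sp[OF assms] unfolding superpattern_iff by blast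
qed

lemma G_in_Superpatterns: "first_order_sp t \<Longrightarrow> G t \<in> Superpatterns ctype"
  using superpattern_G long_nf_G[OF long_nf_first_order[OF first_order_sp_imp]]
  by (auto simp: Superpatterns_def Terms_def)

section \<open>Nullarity\<close>

lemma junky_subst_core: "junky t \<Longrightarrow> core t = None \<Longrightarrow> junky (subst \<sigma> t)"
  by (induction rule: junky.induct) (auto intro: junky.intros)

text \<open>A head f would add 1, and any other constant head survives substitution and evaluates to
  junk; both contradict the value 0. This makes \<open>superpattern_no_consts\<close> applicable to
  \<open>r\<close>.\<close>

lemma core_cases:
  assumes r: "long_nf ctype xy r (Base \<alpha>)" and \<rho>: "is_substitution ctype \<rho>"
    and zero: "S 2 (wY 2 0 True) (wP 2 1) (wP 2 1) [2, 0] (subst \<rho> r) = 0"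
  shows "(\<exists>i. r = Bound i) \<or> (\<exists>X. core r = Some X)"
proof -
  have env: "valid_env 2 [2, 0] xy" and bases: "set xy \<subseteq> range Base" by simp_all
  from r bases show ?thesis
  proof (cases rule: long_nf_base_cases)
    case (f p)
    then show ?thesis
      using zero sem_f[OF bounded_weights has_type_subst[OF \<rho> long_nf_has_type(1)[OF f(3)]] env]
      by (auto simp: wP_def simp del: sem.simps)
  next
    case junky
    show ?thesis
    proof (cases "core r")
      case None
      then show ?thesis
        using zero junky_sem[OF bounded_weights junky_subst_core[OF junky None]
            has_type_subst[OF \<rho> long_nf_has_type(1)[OF r]] env] by simp
    qed simp
  qed auto
qed

text \<open>\<open>G p\<close> is an instance of \<open>G r\<close> with spines, and
  \<open>G q\<close> is its doubling. If \<open>G r\<close> were an instance of \<open>G q\<close>,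
  then so would be \<open>G p\<close>, against \<open>double_not_more_general\<close>. As
  \<open>G p\<close> need not lie in \<open>L\<close>, the chain uses bare instances.\<close>

lemma exists_better_generalization:
  assumes L: "L \<in> {Terms ctype, Superpatterns ctype}"
    and r: "long_nf ctype xy r (Base \<alpha>)"
    and g: "G r \<in> generalizations ctype L (G (Bound 1)) (G (Bound 0))"
  obtains q where "G q \<in> generalizations ctype L (G (Bound 1)) (G (Bound 0))"
    "more_general ctype L (G r) (G q)" "\<not> more_general ctype L (G q) (G r)"
proof -
  have rt: "has_type ctype xy r (Base \<alpha>)" using r by (rule long_nf_has_type)
  have rL: "G r \<in> L" using g by (simp add: generalizations_def)
  obtain \<sigma>1 \<sigma>2 where \<sigma>12: "is_substitution ctype \<sigma>1" "is_substitution ctype \<sigma>2"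
    "cconv ctype [] (subst \<sigma>1 (G r)) (G (Bound 1))" "cconv ctype [] (subst \<sigma>2 (G r)) (G (Bound 0))"
    using g unfolding generalizations_def conv_eq_cconv by blast
  have \<sigma>: "is_substitution ctype (sel d \<sigma>1 \<sigma>2)"
    "cconv ctype [] (subst (sel d \<sigma>1 \<sigma>2) (G r)) (G (Bound (sel d 1 0)))" for d
    using \<sigma>12 by (cases d; simp del: subst_G)+
  obtain \<rho> p k where \<rho>: "is_substitution ctype \<rho>" "cconv ctype xy (subst \<rho> r) p"
    and p: "long_nf ctype xy p (Base \<alpha>)" "\<And>d. spine d (k d) 0 p"
    and syms: "syms p \<subseteq> (syms r \<inter> range Inr) \<union> Inl ` aux_vars"
    and zero: "S 2 (wY 2 0 True) (wP 2 1) (wP 2 1) [2, 0] (subst \<rho> r) = 0"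
    using exists_spine_instance[OF rt, of "\<lambda>d. sel d \<sigma>1 \<sigma>2"] \<sigma> by blast
  have pt: "has_type ctype xy p (Base \<alpha>)" using p(1) by (rule long_nf_has_type)
  note dt = has_type_subst[OF is_substitution_double pt]
  obtain q where q: "long_nf ctype xy q (Base \<alpha>)" "cconv ctype xy (subst double p) q" "G q \<in> L"
  proof (cases "L = Terms ctype")
    case True
    obtain q where q: "long_nf ctype xy q (Base \<alpha>)" "cconv ctype xy (subst double p) q"
      using normalization[OF dt] by blast
    moreover have "G q \<in> L" using long_nf_G[OF q(1)] unfolding True Terms_def by blast
    ultimately show ?thesis by (rule that)
  next
    case False
    then have L: "L = Superpatterns ctype" using L by blast
    \<comment> \<open>Without constants in \<open>r\<close> the term \<open>p\<close> is
      first-order, so that its doubling is a superpattern.\<close>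
    have "syms r \<inter> range Inr = {}"
    proof -
      have "superpattern (G r)" "r \<in> subterms (G r)"
        using rL unfolding L Superpatterns_def by (simp_all add: G_def)
      moreover have "neutral ctype xy r (Base \<alpha>)" using r by (auto elim: long_nf_BaseE)
      ultimately have "syms r \<subseteq> range Inl"
        using core_cases[OF r \<rho>(1) zero] superpattern_no_consts[of "G r" r] by fastforce
      then show ?thesis by auto
    qed
    then have "first_order p" using syms by (intro first_order_if_aux p(1)) simp
    then obtain q where "cconv ctype xy (subst double p) q" "first_order_sp q"
      using double_first_order by blast
    then show ?thesis
      using that G_in_Superpatterns long_nf_first_order first_order_sp_imp unfolding L by blast
  qed
  have qt: "has_type ctype xy q (Base \<alpha>)" using q(1) by (rule long_nf_has_type)
  have "\<exists>m n. spine d m n q" for d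
  proof -
    \<comment> \<open>Doubling puts P on the spines, hence P gets weight 0 here.\<close>
    let ?S = "S 2 (wY 2 0 d) (wP 2 0) (wP 2 1)" and ?env = "sel d [2, 0] [0, 2]"
    interpret model ctype 2 "spec_J 2 (wP 2 1)" "spec_I 2 (wY 2 0 d) (wP 2 0)"
      by (rule spec_model[OF bounded_weights])
    have env: "valid_env 2 ?env xy" by (cases d) auto
    have "?S ?env q = ?S ?env (subst double p)" using sem_cconv[OF q(2) env] by simp
    also have "\<dots> = min 2 (k d * ((if d then 2 else 1) * (0 + 0)) + ?env ! sel d 1 0)"
      by (rule sem_double[OF model_axioms _ _ p(2) pt env])
        (simp_all add: spec_I_def wY_def wP_def image_iff)
    also have "\<dots> = 0" by (cases d) simp_all
    finally show ?thesis using exists_spine[OF q(1)] by blast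
  qed
  then have gen: "G q \<in> generalizations ctype L (G (Bound 1)) (G (Bound 0))"
    by (intro spine_generalization q(3) qt)
  have rp: "cconv ctype [] (subst \<rho> (G r)) (G p)"
    using cconv_G[OF \<rho>(2) has_type_subst[OF \<rho>(1) rt]] by simp
  have pq: "cconv ctype [] (subst double (G p)) (G q)"
    using cconv_G[OF q(2) dt] by simp
  have "more_general ctype L (G r) (G q)"
    using instance_trans[OF \<rho>(1) rp is_substitution_double pq has_type_G[OF rt]] rL q(3)
    unfolding more_general_def conv_eq_cconv by blast
  moreover have "\<not> more_general ctype L (G q) (G r)"
  proof
    assume "more_general ctype L (G q) (G r)"
    then obtain \<tau> where "is_substitution ctype \<tau>" "cconv ctype [] (subst \<tau> (G q)) (G r)"
      unfolding more_general_def conv_eq_cconv by blast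
    from instance_trans[OF this \<rho>(1) rp has_type_G[OF qt]]
    show False using double_not_more_general[OF pt p(2) q(2) qt] by blast
  qed
  ultimately show ?thesis using that gen by blast
qed

lemma more_general_trans:
  assumes "more_general ctype L g g'" "more_general ctype L g' g''" "L \<subseteq> Terms ctype"
  shows "more_general ctype L g g''"
proof -
  obtain T where "has_type ctype [] g T"
    using assms(1,3) long_nf_has_type(1) unfolding more_general_def Terms_def by blast
  then show ?thesis
    using assms(1,2) instance_trans unfolding more_general_def conv_eq_cconv by metis
qed

lemma no_minimal_complete:
  assumes L: "L \<in> {Terms ctype, Superpatterns ctype}"
  shows "\<not> minimal_complete ctype L (G (Bound 1)) (G (Bound 0)) C"
proof
  assume C: "minimal_complete ctype L (G (Bound 1)) (G (Bound 0)) C"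
  let ?gens = "generalizations ctype L (G (Bound 1)) (G (Bound 0))"
  have complete: "C \<subseteq> ?gens" "\<And>g'. g' \<in> ?gens \<Longrightarrow> \<exists>g \<in> C. more_general ctype L g' g"
    and minimal: "\<And>g g'. g \<in> C \<Longrightarrow> g' \<in> C \<Longrightarrow> more_general ctype L g g' \<Longrightarrow> g = g'"
    using C unfolding minimal_complete_def complete_set_def by blast+
  have LT: "L \<subseteq> Terms ctype" "Superpatterns ctype \<subseteq> L"
    using L by (auto simp: Superpatterns_def)
  let ?p = "Y \<alpha> (Bound 1) (Bound 0)"
  have fo: "first_order_sp ?p" by (intro first_order_sp.intros) auto
  have pt: "has_type ctype xy ?p (Base \<alpha>)"
    using fo first_order_sp_imp long_nf_first_order long_nf_has_type(1) by blast
  have "spine d (Suc 0) 0 ?p" for d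
    using spine.intros(1)[of d] by (intro spine.intros(2)) (cases d; simp)
  then have "G ?p \<in> ?gens"
    using G_in_Superpatterns[OF fo] LT(2) by (intro spine_generalization pt) auto
  then obtain g where g: "g \<in> C" "more_general ctype L (G ?p) g" using complete(2) by blast
  obtain \<sigma> T where "is_substitution ctype \<sigma>" "cconv ctype [] (subst \<sigma> (G ?p)) g" "long_nf ctype [] g T"
    using g(2) LT(1) unfolding more_general_def conv_eq_cconv Terms_def by blast
  then obtain r where r: "g = G r" "long_nf ctype xy r (Base \<alpha>)"
    using G_shape[OF _ _ pt] by blast
  obtain q where q: "G q \<in> ?gens" "more_general ctype L g (G q)" "\<not> more_general ctype L (G q) g"
    using exists_better_generalization[OF L r(2)] g(1) complete(1) r(1) by blast
  \<comment> \<open>Completeness puts some \<open>g'\<close> in \<open>C\<close> above the better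
    generalization and so above \<open>g\<close>. Minimality forces \<open>g' = g\<close>, which
    makes \<open>G q\<close> more general than \<open>g\<close>.\<close>
  obtain g' where g': "g' \<in> C" "more_general ctype L (G q) g'" using complete(2)[OF q(1)] by blast
  then have "g = g'" using minimal[OF g(1) g'(1)] more_general_trans[OF q(2) g'(2) LT(1)] by blast
  then show False using g'(2) q(3) by blast
qed

lemma nullary_pair_G:
  assumes "L \<in> {Terms ctype, Superpatterns ctype}"
  shows "nullary_pair ctype L (G (Bound 1)) (G (Bound 0))"
proof -
  have closed: "closed_term ctype (G (Bound i)) (Base \<alpha> \<rightarrow>\<^sub>t Base \<alpha> \<rightarrow>\<^sub>t Base \<alpha>)" if "i < 2" for i
    using that long_nf_G[OF long_nf_first_order[OF first_order.intros(1)]]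
    by (simp add: closed_term_def G_def)
  show ?thesis
    using closed[of 1] closed[of 0] no_minimal_complete[OF assms] unfolding nullary_pair_def by auto
qed

end

theorem mainTheorem1:
  fixes ctype :: "'c \<Rightarrow> 'b ty" and \<alpha> :: 'b and f :: 'c and L :: "('b, 'c) trm set"
  assumes constants_of_every_type: "surj ctype"
    and f: "ctype f = Base \<alpha> \<rightarrow>\<^sub>t Base \<alpha>"
    and L: "L \<in> {Terms ctype, Superpatterns ctype}"
  shows "nullary ctype L \<and>
    nullary_pair ctype L
      (Lam (Base \<alpha>) (Lam (Base \<alpha>) (App (Const f) (Bound 1))))
      (Lam (Base \<alpha>) (Lam (Base \<alpha>) (App (Const f) (Bound 0))))"
proof -
  interpret unary_constant ctype \<alpha> f by unfold_locales (rule f)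
  have "nullary_pair ctype L
      (Lam (Base \<alpha>) (Lam (Base \<alpha>) (App (Const f) (Bound 1))))
      (Lam (Base \<alpha>) (Lam (Base \<alpha>) (App (Const f) (Bound 0))))"
    using nullary_pair_G[OF L] unfolding G_def .
  then show ?thesis unfolding nullary_def by blast
qed

end
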